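(* Let $m\ge1$ and $N\ge1$ be integers, $z\in[0,1]$, $x_1,\dots,x_N\in[0,1]$, and let $C_1(z),\dots,C_N(z)$ be real numbers with $\sum_{k=1}^N C_k(z)=1$. Then the error functional $\ell$ given by $(\ell,\varphi)=\varphi(z)-\sum_{k=1}^N C_k(z)\varphi(x_k)$ satisfies $$\left\|\ell\,|\,\widetilde{L_2^{(m)*}}(0,1)\right\|^2=(-1)^m\left[B_{2m}(0)-2\sum_{k=1}^N C_k(z)B_{2m}(z-x_k)+\sum_{k=1}^N\sum_{k'=1}^N C_k(z)C_{k'}(z)B_{2m}(x_k-x_{k'})\right].$$
   Context: $B_{2m}(x)=\sum_{\beta\in\mathbb{Z},\,\beta\ne0}\frac{\exp(-2\pi i\beta x)}{(2\pi i\beta)^{2m}}$. $\widetilde{L_2^{(m)}}(0,1)$ is the Hilbert space of real 1-periodic functions $\varphi$ on $\mathbb{R}$ with locally summable derivatives up to order $m$ and $\int_0^1(\varphi^{(m)}(x))^2dx<\infty$, where functions differing by a constant are identified, with norm $\|\varphi\|=\left(\int_0^1(\varphi^{(m)}(x))^2dx\right)^{1/2}$. $\widetilde{L_2^{(m)*}}(0,1)$ is its dual space, with norm $\|\ell\,|\,\widetilde{L_2^{(m)*}}(0,1)\|=\sup_{\|\varphi\|=1}|(\ell,\varphi)|$; the condition $\sum_k C_k(z)=1$ is the requirement $(\ell,1)=0$. *)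

theory Defs
  imports "HOL-Analysis.Analysis"
begin

definition locally_summable :: "(real \<Rightarrow> real) \<Rightarrow> bool" where
  "locally_summable f \<longleftrightarrow> (\<forall>a b. f absolutely_integrable_on {a..b})"

definition test_function :: "(real \<Rightarrow> real) \<Rightarrow> bool" where
  "test_function \<psi> \<longleftrightarrow>
     (\<forall>n x. (deriv ^^ n) \<psi> field_differentiable (at x)) \<and>
     (\<exists>a b. \<forall>x. x \<notin> {a..b} \<longrightarrow> \<psi> x = 0)"

text \<open>Derivatives are generalized derivatives in the sense of Sobolev.\<close>

definition has_weak_deriv :: "nat \<Rightarrow> (real \<Rightarrow> real) \<Rightarrow> (real \<Rightarrow> real) \<Rightarrow> bool" where
  "has_weak_deriv n f g \<longleftrightarrow>
     locally_summable f \<and> locally_summable g \<and>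
     (\<forall>\<psi>. test_function \<psi> \<longrightarrow>
        (LINT x|lebesgue. f x * (deriv ^^ n) \<psi> x) = (-1) ^ n * (LINT x|lebesgue. g x * \<psi> x))"

text \<open>A generalized derivative is determined only almost everywhere; the choice below is used
  only under an integral sign.\<close>

definition weak_deriv :: "nat \<Rightarrow> (real \<Rightarrow> real) \<Rightarrow> (real \<Rightarrow> real)" where
  "weak_deriv n f = (SOME g. has_weak_deriv n f g)"

text \<open>A function with a locally summable generalized derivative of order at least one agrees
  almost everywhere with exactly one continuous function. The set below consists of these
  continuous representatives, so that point values make sense.\<close>

definition periodic_L2 :: "nat \<Rightarrow> (real \<Rightarrow> real) set" where
  "periodic_L2 m = {\<phi>. continuous_on UNIV \<phi> \<and> (\<forall>x. \<phi> (x + 1) = \<phi> x) \<and>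
     (\<forall>j\<le>m. \<exists>g. has_weak_deriv j \<phi> g) \<and>
     (\<lambda>x. (weak_deriv m \<phi> x)\<^sup>2) absolutely_integrable_on {0..1}}"

definition periodic_L2_norm :: "nat \<Rightarrow> (real \<Rightarrow> real) \<Rightarrow> real" where
  "periodic_L2_norm m \<phi> = sqrt (set_lebesgue_integral lebesgue {0..1} (\<lambda>x. (weak_deriv m \<phi> x)\<^sup>2))"

text \<open>Functions that differ by a constant are identified. The quotient is not formed explicitly:
  linear functionals on it are linear functionals on \<open>periodic_L2 m\<close> that vanish on the
  constants.\<close>

definition periodic_L2_dual :: "nat \<Rightarrow> ((real \<Rightarrow> real) \<Rightarrow> real) set" where
  "periodic_L2_dual m = {l.
     (\<forall>\<phi>\<in>periodic_L2 m. \<forall>\<psi>\<in>periodic_L2 m. \<forall>a b. l (\<lambda>x. a * \<phi> x + b * \<psi> x) = a * l \<phi> + b * l \<psi>) \<and>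
     (\<forall>c. l (\<lambda>_. c) = 0) \<and>
     (\<exists>K. \<forall>\<phi>\<in>periodic_L2 m. \<bar>l \<phi>\<bar> \<le> K * periodic_L2_norm m \<phi>)}"

text \<open>The supremum is taken in the reals; it is meaningful for members of \<open>periodic_L2_dual m\<close>.\<close>

definition periodic_L2_dual_norm :: "nat \<Rightarrow> ((real \<Rightarrow> real) \<Rightarrow> real) \<Rightarrow> real" where
  "periodic_L2_dual_norm m l =
     (SUP \<phi>\<in>{\<phi> \<in> periodic_L2 m. periodic_L2_norm m \<phi> = 1}. \<bar>l \<phi>\<bar>)"

text \<open>\<open>bernoulli_even m\<close> is the function written $B_{2m}$, for $m \ge 1$.\<close>

definition bernoulli_even :: "nat \<Rightarrow> real \<Rightarrow> complex" where
  "bernoulli_even m x =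
     (\<Sum>\<^sub>\<infinity>\<beta>\<in>UNIV - {0::int}. exp (- 2 * of_real pi * \<i> * of_int \<beta> * of_real x)
                               / (2 * of_real pi * \<i> * of_int \<beta>) ^ (2 * m))"

definition error_functional ::
    "nat \<Rightarrow> (nat \<Rightarrow> real) \<Rightarrow> (nat \<Rightarrow> real) \<Rightarrow> real \<Rightarrow> (real \<Rightarrow> real) \<Rightarrow> real" where
  "error_functional N C x z \<phi> = \<phi> z - (\<Sum>k=1..N. C k * \<phi> (x k))"

end

theory Submission
  imports Defs
begin

text \<open>Put $A_n = (\ell, \cos 2\pi n x)$ and $B_n = (\ell, \sin 2\pi n x)$. Expanding the cosines in
  $B_{2m}$, the right-hand side is the energy $S = \sum_{n\ge1} 2 (A_n^2 + B_n^2) / (2\pi n)^{2m}$.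

  Upper bound: by Fejer's theorem $(\ell,\varphi)$ is the limit of the values of $\ell$ at the Cesaro
  means of $\varphi$. Each of these is $\int_0^1 \varphi W$ with a trigonometric polynomial $W = Q^{(m)}$
  (the constant mode drops out because $(\ell,1)=0$), hence equals $\pm\int_0^1 \varphi^{(m)} Q$, and
  $\|Q\|_2^2 \le S$. Lower bound: the partial sums of the Riesz representer are trigonometric
  polynomials $u$ with $(\ell,u) = \|u\|^2$ equal to a partial sum of $S$.

  A generalized derivative is tested only against compactly supported functions. To test it against
  a periodic function, the latter is multiplied by a smooth cut-off whose integer translates sum
  to one.\<close>

section \<open>Smooth functions on the line\<close>

text \<open>Cesaro means converge at every point for any continuous periodic function, so point
  values are reached without rates or smoothness. They also keep the analysis finite: only
  trigonometric polynomials are differentiated, and the infinite series occurs solely as the number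
  S. The Fejer weights lie between 0 and 1, so damping the modes can only lower the norm of Q. The
  factor 2 in S has two sources that agree: B_{2m} pairs the frequencies n and -n into 2 cos, while
  cos and sin have mean square 1/2, which forces the coefficients 2 A_n / (2 pi n)^{2m} and 2 B_n /
  (2 pi n)^{2m} on the representer. The sign (-1)^m comes from i^{2m}. The obstacle is that a
  generalized derivative is an arbitrary choice from an almost-everywhere class. The lemma of du
  Bois-Reymond is needed twice: to identify the chosen derivative of a trigonometric polynomial with
  the classical one, and to see that the generalized derivative of a periodic function is periodic
  almost everywhere, so that integrals over the line fold to one period.\<close>

fun ndiff :: "nat \<Rightarrow> (real \<Rightarrow> real) \<Rightarrow> bool" where
  "ndiff 0 f \<longleftrightarrow> True"
| "ndiff (Suc n) f \<longleftrightarrow> (\<forall>x. f field_differentiable at x) \<and> ndiff n (deriv f)"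

definition smooth :: "(real \<Rightarrow> real) \<Rightarrow> bool" where
  "smooth f \<longleftrightarrow> (\<forall>n x. (deriv ^^ n) f field_differentiable at x)"

text \<open>The recursive form peels off the innermost derivative, so closure rules can be proved by
  induction on the order with the function generalized.\<close>

lemma ndiff_iff: "ndiff n f \<longleftrightarrow> (\<forall>k<n. \<forall>x. (deriv ^^ k) f field_differentiable at x)"
proof (induction n arbitrary: f)
  case (Suc n)
  show ?case
    by (simp add: Suc.IH All_less_Suc2 funpow_swap1)
qed simp

lemma smooth_iff_ndiff: "smooth f \<longleftrightarrow> (\<forall>n. ndiff n f)"
  unfolding smooth_def ndiff_iff by blast

lemma ndiff_mono: "ndiff n f \<Longrightarrow> m \<le> n \<Longrightarrow> ndiff m f"
  by (auto simp: ndiff_iff)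

lemma smooth_differentiable: "smooth f \<Longrightarrow> f field_differentiable at x"
  unfolding smooth_def by (metis funpow_0)

lemma smooth_DERIV: "smooth f \<Longrightarrow> (f has_real_derivative deriv f x) (at x)"
  using smooth_differentiable field_differentiable_derivI by blast

lemma smooth_deriv: "smooth f \<Longrightarrow> smooth (deriv f)"
  unfolding smooth_def by (metis comp_apply funpow_Suc_right)

lemma smooth_funpow_deriv: "smooth f \<Longrightarrow> smooth ((deriv ^^ n) f)"
  by (induction n) (auto intro: smooth_deriv)

lemma smooth_continuous_on: "smooth f \<Longrightarrow> continuous_on A f"
  by (meson DERIV_continuous_on has_field_derivative_at_within smooth_DERIV)

lemma ndiff_const: "ndiff n (\<lambda>x. c)"
proof (induction n arbitrary: c)
  case (Suc n)
  have "deriv (\<lambda>x. c) = (\<lambda>x::real. 0::real)" by (simp add: fun_eq_iff)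
  then show ?case using Suc by auto
qed simp

lemma ndiff_add: "ndiff n f \<Longrightarrow> ndiff n g \<Longrightarrow> ndiff n (\<lambda>x. f x + g x)"
proof (induction n arbitrary: f g)
  case (Suc n)
  have "deriv (\<lambda>x. f x + g x) = (\<lambda>x. deriv f x + deriv g x)"
    using Suc.prems by (intro ext deriv_add) auto
  then show ?case
    using Suc by (auto intro: field_differentiable_add)
qed simp

lemma ndiff_mult: "ndiff n f \<Longrightarrow> ndiff n g \<Longrightarrow> ndiff n (\<lambda>x. f x * g x)"
proof (induction n arbitrary: f g)
  case (Suc n)
  have "deriv (\<lambda>x. f x * g x) = (\<lambda>x. f x * deriv g x + deriv f x * g x)"
    using Suc.prems by (intro ext deriv_mult) auto
  moreover have "ndiff n f" "ndiff n g"
    using Suc.prems by (blast intro: ndiff_mono le_SucI)+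
  ultimately show ?case
    using Suc by (auto intro: field_differentiable_mult ndiff_add)
qed simp

lemma deriv_affine:
  fixes f :: "real \<Rightarrow> real"
  assumes "\<And>x. f field_differentiable at x"
  shows "((\<lambda>x. f (a * x + b)) has_real_derivative (a * deriv f (a * x + b))) (at x)"
proof -
  have "((\<lambda>x. f (a * x + b)) has_real_derivative (deriv f (a * x + b) * a)) (at x)"
    by (rule DERIV_chain2[where f=f])
      (use assms in \<open>auto intro!: field_differentiable_derivI derivative_eq_intros\<close>)
  then show ?thesis by (simp add: mult.commute)
qed

lemma ndiff_affine: "ndiff n f \<Longrightarrow> ndiff n (\<lambda>x. f (a * x + b))"
proof (induction n arbitrary: f)
  case (Suc n)
  have D: "((\<lambda>x. f (a * x + b)) has_real_derivative (a * deriv f (a * x + b))) (at x)" for x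
    using Suc.prems by (intro deriv_affine) auto
  then have "deriv (\<lambda>x. f (a * x + b)) = (\<lambda>x. a * deriv f (a * x + b))"
    by (intro ext DERIV_imp_deriv)
  moreover have "ndiff n (\<lambda>x. a * deriv f (a * x + b))"
    using Suc by (intro ndiff_mult ndiff_const) auto
  ultimately show ?case
    using D by (auto simp: field_differentiable_def)
qed simp

text \<open>The derivative -f'/f^2 is a product of \<open>deriv f\<close> and two copies of the
  reciprocal, so the induction hypothesis and the product rule settle the next order.\<close>

lemma ndiff_inverse: "ndiff n f \<Longrightarrow> (\<And>x. f x \<noteq> 0) \<Longrightarrow> ndiff n (\<lambda>x. inverse (f x))"
proof (induction n arbitrary: f)
  case (Suc n)
  have D: "((\<lambda>x. inverse (f x)) has_real_derivative
      (-1) * (deriv f x * (inverse (f x) * inverse (f x)))) (at x)" for x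
    using Suc.prems by (auto intro!: derivative_eq_intros field_differentiable_derivI[of f] simp: mult_ac)
  then have "deriv (\<lambda>x. inverse (f x)) = (\<lambda>x. (-1) * (deriv f x * (inverse (f x) * inverse (f x))))"
    by (intro ext DERIV_imp_deriv)
  moreover have "ndiff n (\<lambda>x. inverse (f x))"
    using Suc.prems by (intro Suc.IH) (blast intro: ndiff_mono le_SucI)+
  then have "ndiff n (\<lambda>x. (-1) * (deriv f x * (inverse (f x) * inverse (f x))))"
    using Suc.prems by (intro ndiff_mult ndiff_const) auto
  ultimately show ?case
    using D by (auto simp: field_differentiable_def)
qed simp

lemma smooth_const: "smooth (\<lambda>x. c)"
  and smooth_add: "smooth f \<Longrightarrow> smooth g \<Longrightarrow> smooth (\<lambda>x. f x + g x)"
  and smooth_mult: "smooth f \<Longrightarrow> smooth g \<Longrightarrow> smooth (\<lambda>x. f x * g x)"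
  and smooth_affine: "smooth f \<Longrightarrow> smooth (\<lambda>x. f (a * x + b))"
  and smooth_inverse: "smooth f \<Longrightarrow> (\<And>x. f x \<noteq> 0) \<Longrightarrow> smooth (\<lambda>x. inverse (f x))"
  using ndiff_const ndiff_add ndiff_mult ndiff_affine ndiff_inverse by (auto simp: smooth_iff_ndiff)

lemma smooth_sum: "(\<And>i. i \<in> I \<Longrightarrow> smooth (f i)) \<Longrightarrow> smooth (\<lambda>x. \<Sum>i\<in>I. f i x)"
  by (induction I rule: infinite_finite_induct) (auto intro: smooth_const smooth_add)

lemma smooth_diff:
  assumes "smooth f" "smooth g"
  shows "smooth (\<lambda>x. f x - g x)"
  using smooth_add[OF assms(1) smooth_mult[OF smooth_const[of "-1"] assms(2)]] by simp

lemma deriv_diff_funpow: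
  assumes "smooth f" "smooth g"
  shows "(deriv ^^ n) (\<lambda>x. f x - g x) = (\<lambda>x. (deriv ^^ n) f x - (deriv ^^ n) g x)"
proof (induction n)
  case (Suc n)
  show ?case
    using assms by (auto simp: Suc intro!: ext deriv_diff smooth_differentiable smooth_funpow_deriv)
qed simp

lemma deriv_shift_funpow:
  assumes "smooth f"
  shows "(deriv ^^ n) (\<lambda>x. f (x + c)) = (\<lambda>x. (deriv ^^ n) f (x + c))"
proof (induction n)
  case (Suc n)
  show ?case
    using deriv_affine[of "(deriv ^^ n) f" 1 c] assms
    by (auto simp: Suc intro!: ext DERIV_imp_deriv smooth_differentiable smooth_funpow_deriv)
qed simp

text \<open>Cut-offs agree with zero or with a given function only on half-lines; openness of
  \<open>U\<close> lets the agreement survive differentiation.\<close>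

lemma funpow_deriv_cong_open:
  fixes f g :: "real \<Rightarrow> real"
  assumes "open U" "\<And>x. x \<in> U \<Longrightarrow> f x = g x"
  shows "x \<in> U \<Longrightarrow> (deriv ^^ n) f x = (deriv ^^ n) g x"
proof (induction n arbitrary: x)
  case (Suc n)
  have "eventually (\<lambda>y. (deriv ^^ n) f y = (deriv ^^ n) g y) (nhds x)"
    using Suc assms(1) eventually_nhds by blast
  then show ?case by (auto intro: deriv_cong_ev)
qed (use assms in auto)

lemma smooth_sin_cos: "smooth sin" "smooth cos"
proof -
  \<comment> \<open>Combinations of sine and cosine are closed under differentiation, so one
    induction serves both.\<close>
  have "ndiff n (\<lambda>x. a * sin x + b * cos x)" for n a b
  proof (induction n arbitrary: a b)
    case (Suc n)
    have D: "((\<lambda>x. a * sin x + b * cos x) has_real_derivative (- b * sin x + a * cos x)) (at x)" for x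
      by (auto intro!: derivative_eq_intros)
    then have "deriv (\<lambda>x. a * sin x + b * cos x) = (\<lambda>x. - b * sin x + a * cos x)"
      by (intro ext DERIV_imp_deriv)
    then show ?case using D Suc[of "-b" a] by (auto simp: field_differentiable_def)
  qed simp
  from this[of _ 1 0] this[of _ 0 1] show "smooth sin" "smooth cos"
    by (simp_all add: smooth_iff_ndiff)
qed

section \<open>A smooth step function built from exp(-1/x)\<close>

definition flat :: "nat \<Rightarrow> real \<Rightarrow> real" where
  "flat k x = (if x > 0 then exp (- inverse x) * inverse x ^ k else 0)"

text \<open>With y = 1/x this is the decay of y^k exp(-y) at infinity; to the left of 0 the function
  is identically zero.\<close>

lemma flat_tendsto_0: "(flat k \<longlongrightarrow> 0) (at 0)"
proof -
  have "((\<lambda>x::real. x ^ k / exp x) \<longlongrightarrow> 0) at_top"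
    by (rule tendsto_power_div_exp_0)
  then have "((\<lambda>x::real. inverse x ^ k / exp (inverse x)) \<longlongrightarrow> 0) (at_right 0)"
    using filterlim_compose filterlim_inverse_at_top_right by blast
  then have r: "(flat k \<longlongrightarrow> 0) (at_right 0)"
    by (rule Lim_transform_eventually)
      (auto simp: flat_def eventually_at_right_less exp_minus divide_simps
         intro!: eventually_mono[OF eventually_at_right_less])
  have "(flat k \<longlongrightarrow> 0) (at_left 0)"
    by (rule Lim_transform_eventually[OF tendsto_const])
      (auto simp: flat_def eventually_at_left_real[of "-1"] intro!: eventually_at_leftI[of "-1"])
  with r show ?thesis by (simp add: filterlim_split_at)
qed

text \<open>Powers of 1/x are carried along so that the derivative of a member of the family is a
  combination of members; smoothness is then one induction.\<close>

lemma flat_DERIV: "(flat k has_real_derivative flat (k + 2) x - k * flat (Suc k) x) (at x)"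
proof -
  consider "x < 0" | "x = 0" | "x > 0" by linarith
  then show ?thesis
  proof cases
    case 1
    have "((\<lambda>_. 0) has_real_derivative 0) (at x)" by simp
    then have "(flat k has_real_derivative 0) (at x)"
      by (rule DERIV_cong_ev[THEN iffD1, rotated -1])
        (use 1 in \<open>auto simp: flat_def eventually_nhds intro!: exI[of _ "{..<0}"]\<close>)
    with 1 show ?thesis by (simp add: flat_def)
  next
    case 2
    \<comment> \<open>The difference quotient at the origin is \<open>flat (Suc k)\<close>
      itself.\<close>
    have "((\<lambda>h. (flat k (0 + h) - flat k 0) / h) \<longlongrightarrow> 0) (at 0)"
      by (rule Lim_transform_eventually[OF flat_tendsto_0[of "Suc k"]])
        (auto simp: flat_def divide_simps)
    with 2 show ?thesis by (simp add: DERIV_def flat_def)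
  next
    case 3
    have "((\<lambda>x. exp (- inverse x) * inverse x ^ k) has_real_derivative
        exp (- inverse x) * inverse x ^ 2 * inverse x ^ k
          + exp (- inverse x) * (k * inverse x ^ (k - 1) * (- (inverse x ^ 2)))) (at x)"
      using 3 by (auto intro!: derivative_eq_intros simp: power2_eq_square)
    moreover have "exp (- inverse x) * inverse x ^ 2 * inverse x ^ k
          + exp (- inverse x) * (k * inverse x ^ (k - 1) * (- (inverse x ^ 2)))
        = flat (k + 2) x - k * flat (Suc k) x"
      using 3 by (cases k) (auto simp: flat_def power2_eq_square algebra_simps)
    ultimately have "((\<lambda>x. exp (- inverse x) * inverse x ^ k) has_real_derivative
        flat (k + 2) x - k * flat (Suc k) x) (at x)"
      by (simp only:)
    then show ?thesis
      by (rule DERIV_cong_ev[THEN iffD1, rotated -1])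
        (use 3 in \<open>auto simp: flat_def eventually_nhds intro!: exI[of _ "{0<..}"]\<close>)
  qed
qed

lemma smooth_flat: "smooth (flat k)"
proof -
  have "ndiff n (flat k)" for n
  proof (induction n arbitrary: k)
    case (Suc n)
    have "deriv (flat k) = (\<lambda>x. flat (k + 2) x + (- real k) * flat (Suc k) x)"
      using DERIV_imp_deriv[OF flat_DERIV] by (auto simp: fun_eq_iff)
    moreover have "ndiff n (\<lambda>x. flat (k + 2) x + (- real k) * flat (Suc k) x)"
      by (intro ndiff_add ndiff_mult ndiff_const Suc)
    moreover have "flat k field_differentiable at x" for x
      using flat_DERIV field_differentiable_def by blast
    ultimately show ?case
      by (simp only: ndiff.simps) simp
  qed simp
  then show ?thesis by (simp add: smooth_iff_ndiff)
qed

text \<open>The classical quotient f(x) / (f(x) + f(1 - x)) with f = \<open>flat 0\<close>: at least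
  one of x and 1 - x is positive, so the denominator never vanishes.\<close>

lemma smooth_step_exists:
  obtains R :: "real \<Rightarrow> real" where "smooth R" "\<And>x. x \<le> 0 \<Longrightarrow> R x = 0" "\<And>x. x \<ge> 1 \<Longrightarrow> R x = 1"
    "\<And>x. \<bar>R x\<bar> \<le> 1"
proof
  define d where "d = (\<lambda>x. flat 0 x + flat 0 ((-1) * x + 1))"
  define R where "R = (\<lambda>x. flat 0 x * inverse (d x))"
  have nn: "flat 0 x \<ge> 0" for x by (simp add: flat_def)
  have pos: "d x > 0" for x by (auto simp: d_def flat_def add_pos_pos)
  have "smooth d" unfolding d_def by (intro smooth_add smooth_flat smooth_affine)
  moreover have "d x \<noteq> 0" for x using pos[of x] by simp
  ultimately show "smooth R" unfolding R_def by (intro smooth_mult smooth_flat smooth_inverse)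
  show "R x = 0" if "x \<le> 0" for x using that by (simp add: R_def flat_def)
  show "R x = 1" if "x \<ge> 1" for x using that by (simp add: R_def d_def flat_def)
  show "\<bar>R x\<bar> \<le> 1" for x
  proof -
    have "flat 0 x \<le> d x" using nn[of "(-1) * x + 1"] by (simp add: d_def)
    then show ?thesis using nn[of x] pos[of x] by (simp add: R_def divide_simps)
  qed
qed

section \<open>Generalized derivatives\<close>

lemma test_function_iff:
  "test_function \<psi> \<longleftrightarrow> smooth \<psi> \<and> (\<exists>a b. \<forall>x. x \<notin> {a..b} \<longrightarrow> \<psi> x = 0)"
  by (simp add: test_function_def smooth_def)

lemma absolutely_integrable_mult_continuous:
  fixes f g :: "real \<Rightarrow> real"
  assumes "f absolutely_integrable_on {a..b}" "continuous_on {a..b} g"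
  shows "(\<lambda>x. f x * g x) absolutely_integrable_on {a..b}"
proof -
  have "(\<lambda>x. g x * f x) absolutely_integrable_on {a..b}"
  proof (rule absolutely_integrable_bounded_measurable_product_real)
    show "g \<in> borel_measurable (lebesgue_on {a..b})"
      by (intro continuous_imp_measurable_on_sets_lebesgue assms) auto
    show "bounded (g ` {a..b})"
      by (intro compact_imp_bounded compact_continuous_image assms) auto
  qed (use assms in auto)
  then show ?thesis by (simp add: mult.commute)
qed

lemma locally_summableD: "locally_summable f \<Longrightarrow> f absolutely_integrable_on {a..b}"
  by (simp add: locally_summable_def)

lemma locally_summable_mult_continuous:
  "locally_summable f \<Longrightarrow> continuous_on {a..b} g \<Longrightarrow> (\<lambda>x. f x * g x) absolutely_integrable_on {a..b}"
  by (intro absolutely_integrable_mult_continuous locally_summableD)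

lemma continuous_locally_summable: "continuous_on UNIV f \<Longrightarrow> locally_summable f"
  unfolding locally_summable_def
  by (auto intro!: absolutely_integrable_continuous_real intro: continuous_on_subset)

text \<open>Generalized derivatives are defined by Lebesgue integrals over the line, while
  splitting, shifting and the fundamental theorem are applied to gauge integrals over intervals;
  compact support links the two.\<close>

lemma lebesgue_integral_eq_integral_Icc:
  fixes h :: "real \<Rightarrow> real"
  assumes "h absolutely_integrable_on {a..b}" "\<And>x. x \<notin> {a..b} \<Longrightarrow> h x = 0"
  shows "(LINT x|lebesgue. h x) = integral {a..b} h"
proof -
  have "(LINT x|lebesgue. h x) = (LINT x:{a..b}|lebesgue. h x)"
    unfolding set_lebesgue_integral_def
    by (intro Bochner_Integration.integral_cong) (use assms(2) in \<open>auto split: split_indicator\<close>)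
  with assms(1) show ?thesis by (simp add: set_lebesgue_integral_eq_integral)
qed

section \<open>Functions annihilated by all test functions\<close>

lemma AE_eq_0_if_integral_rays_0:
  fixes H :: "real \<Rightarrow> real"
  assumes H: "integrable lebesgue H" and rays: "\<And>x. (LINT y:{x<..}|lebesgue. H y) = 0"
  shows "AE x in lebesgue. H x = 0"
proof -
  \<comment> \<open>Uniqueness of measures from their values on rays concerns Borel measures, so
    \<open>H\<close> is replaced by an almost everywhere equal Borel function.\<close>
  obtain G where G: "G \<in> borel_measurable lborel" and HG: "AE x in lborel. H x = G x"
    using completion_ex_borel_measurable_real[of H lborel] H by (auto dest: borel_measurable_integrable)
  have HG': "AE x in lebesgue. H x = G x"
    using HG by (rule AE_completion)
  have Gm: "G \<in> borel_measurable lebesgue"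
    using G by (rule measurable_completion)
  have intG: "integrable lebesgue G"
    using integrable_cong_AE[OF _ Gm HG'] H by (auto dest: borel_measurable_integrable)
  then have iG: "integrable lborel G"
    using G integrable_completion by blast
  have z: "(LINT y:{x<..}|lborel. G y) = 0" for x
  proof -
    have "(LINT y:{x<..}|lborel. G y) = (LINT y:{x<..}|lebesgue. G y)"
      unfolding set_lebesgue_integral_def
      by (rule integral_completion[symmetric]) (use G in measurable)
    also have "\<dots> = (LINT y:{x<..}|lebesgue. H y)"
      unfolding set_lebesgue_integral_def
      by (rule integral_cong_AE)
         (use HG' Gm borel_measurable_integrable[OF H] in
           \<open>auto intro!: borel_measurable_times borel_measurable_indicator\<close>)
    finally show ?thesis using rays by simp
  qed
  \<comment> \<open>\<open>ennreal\<close> truncates negative values, so the densities are the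
    positive and negative parts of \<open>G\<close>. The two measures are finite and equal on all
    open rays, which determines them.\<close>
  let ?P = "density lborel (\<lambda>x. ennreal (G x))" and ?Q = "density lborel (\<lambda>x. ennreal (- G x))"
  have fin: "(\<integral>\<^sup>+x. ennreal (G x) * indicator {a<..} x \<partial>lborel) < \<infinity>"
    and eq: "(\<integral>\<^sup>+x. ennreal (G x) * indicator {a<..} x \<partial>lborel)
      = (\<integral>\<^sup>+x. ennreal (- G x) * indicator {a<..} x \<partial>lborel)" for a
  proof -
    let ?g = "\<lambda>x. indicator {a<..} x * G x"
    have ig: "integrable lborel ?g"
      using integrable_mult_indicator[OF _ iG, of "{a<..}"] by simp
    have e: "(\<integral>\<^sup>+x. ennreal (c * G x) * indicator {a<..} x \<partial>lborel) = (\<integral>\<^sup>+x. ennreal (c * ?g x) \<partial>lborel)" for c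
      by (intro nn_integral_cong) (auto split: split_indicator)
    have f: "(\<integral>\<^sup>+x. ennreal (?g x) \<partial>lborel) < \<infinity>" "(\<integral>\<^sup>+x. ennreal (- ?g x) \<partial>lborel) < \<infinity>"
      using ig unfolding real_integrable_def by (auto simp: top.not_eq_extremum)
    moreover have "enn2real (\<integral>\<^sup>+x. ennreal (?g x) \<partial>lborel) = enn2real (\<integral>\<^sup>+x. ennreal (- ?g x) \<partial>lborel)"
      using real_lebesgue_integral_def[OF ig] z[of a] by (simp add: set_lebesgue_integral_def)
    ultimately have "(\<integral>\<^sup>+x. ennreal (?g x) \<partial>lborel) = (\<integral>\<^sup>+x. ennreal (- ?g x) \<partial>lborel)"
      by (metis ennreal_enn2real infinity_ennreal_def)
    with f show "(\<integral>\<^sup>+x. ennreal (G x) * indicator {a<..} x \<partial>lborel) < \<infinity>"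
      "(\<integral>\<^sup>+x. ennreal (G x) * indicator {a<..} x \<partial>lborel)
      = (\<integral>\<^sup>+x. ennreal (- G x) * indicator {a<..} x \<partial>lborel)"
      using e[of 1] e[of "-1"] by simp_all
  qed
  have "?P = ?Q"
    by (rule measure_eqI_lessThan) (use G fin eq in \<open>auto simp: emeasure_density\<close>)
  then have "AE x in lborel. ennreal (G x) = ennreal (- G x)"
    by (intro sigma_finite_measure.density_unique_iff[OF sigma_finite_lborel, THEN iffD1]) (use G in auto)
  \<comment> \<open>One of u and -u is nonpositive, so its truncation is zero, and equality makes
    both truncations zero.\<close>
  moreover have "u = 0" if "ennreal u = ennreal (- u)" for u
  proof -
    have "ennreal u = 0 \<or> ennreal (- u) = 0"
      using ennreal_neg[of u] ennreal_neg[of "- u"] by linarith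
    with that have "ennreal u = 0" "ennreal (- u) = 0" by auto
    then show ?thesis unfolding ennreal_eq_0_iff by simp
  qed
  ultimately have "AE x in lborel. G x = 0" by auto
  then have "AE x in lebesgue. G x = 0" by (rule AE_completion)
  with HG' show ?thesis by auto
qed

text \<open>Truncation to \<open>{- real n..real n}\<close> gives integrable functions, and a ray
  meets such an interval in an interval up to one point. Countably many null sets remain.\<close>

lemma AE_eq_0_if_integral_Icc_0:
  fixes h :: "real \<Rightarrow> real"
  assumes h: "locally_summable h" and 0: "\<And>a b. integral {a..b} h = 0"
  shows "AE x in lebesgue. h x = 0"
proof -
  have "AE x in lebesgue. indicator {- real n..real n} x * h x = 0" for n
  proof (rule AE_eq_0_if_integral_rays_0)
    have "h absolutely_integrable_on {- real n..real n}"
      using h by (rule locally_summableD)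
    then show "integrable lebesgue (\<lambda>x. indicator {- real n..real n} x * h x)"
      by (simp add: set_integrable_def)
    fix x
    let ?S = "{x<..} \<inter> {- real n..real n}"
    have "h absolutely_integrable_on ?S"
      using set_integrable_subset[OF locally_summableD[OF h], of ?S "- real n" "real n"] by auto
    then have "(LINT y:?S|lebesgue. h y) = integral ?S h"
      by (simp add: set_lebesgue_integral_eq_integral)
    also have "\<dots> = integral {max x (- real n)..real n} h"
      by (rule integral_spike_set; rule negligible_subset[of "{x}"]) auto
    finally have "(LINT y:?S|lebesgue. h y) = 0" using 0 by simp
    moreover have "(LINT y:{x<..}|lebesgue. indicator {- real n..real n} y * h y) = (LINT y:?S|lebesgue. h y)"
      unfolding set_lebesgue_integral_def
      by (intro Bochner_Integration.integral_cong) (auto split: split_indicator)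
    ultimately show "(LINT y:{x<..}|lebesgue. indicator {- real n..real n} y * h y) = 0" by simp
  qed
  then have "AE x in lebesgue. \<forall>n. indicator {- real n..real n} x * h x = 0"
    by (subst AE_all_countable) blast
  then show ?thesis
  proof eventually_elim
    case (elim x)
    obtain n where "\<bar>x\<bar> \<le> real n" using real_arch_simple by blast
    then have "x \<in> {- real n..real n}" by auto
    with elim[rule_format, of n] show ?case by simp
  qed
qed

text \<open>Smooth plateau functions bounded by 1 converge to the indicator of an open interval, so
  dominated convergence turns the hypothesis into vanishing integrals over intervals.\<close>

lemma du_Bois_Reymond:
  assumes h: "locally_summable h" and 0: "\<And>\<psi>. test_function \<psi> \<Longrightarrow> (LINT x|lebesgue. h x * \<psi> x) = 0"
  shows "AE x in lebesgue. h x = 0"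
proof (rule AE_eq_0_if_integral_Icc_0[OF h])
  fix a b :: real
  obtain R where R: "smooth R" "\<And>x. x \<le> 0 \<Longrightarrow> R x = 0" "\<And>x. x \<ge> 1 \<Longrightarrow> R x = 1" "\<And>x. \<bar>R x\<bar> \<le> 1"
    using smooth_step_exists by metis
  \<comment> \<open>The factors are R(k (x - a)) and R(k (b - x)): for positive k, one rises within
    distance 1/k to the right of \<open>a\<close>, the other falls within that distance to the left
    of \<open>b\<close>.\<close>
  define \<psi> where "\<psi> k x = R (real k * x + (- (real k * a))) * R (- real k * x + real k * b)" for k :: nat and x
  have sm: "smooth (\<psi> k)" for k
    unfolding \<psi>_def by (intro smooth_mult smooth_affine R)
  have out: "\<psi> k x = 0" if "x \<notin> {a<..<b}" for k x
  proof -
    have "x \<le> a \<or> x \<ge> b" using that by auto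
    then have "real k * x + (- (real k * a)) \<le> 0 \<or> - real k * x + real k * b \<le> 0"
      by (auto simp: mult_left_mono)
    then show ?thesis using R(2) by (auto simp: \<psi>_def)
  qed
  have int: "(\<lambda>x. h x * \<psi> k x) absolutely_integrable_on {a..b}" for k
    by (intro locally_summable_mult_continuous h smooth_continuous_on sm)
  have z: "integral {a..b} (\<lambda>x. h x * \<psi> k x) = 0" for k
  proof -
    have "test_function (\<psi> k)"
      unfolding test_function_iff using sm out by (intro conjI exI[of _ a] exI[of _ b]) auto
    moreover have "(LINT x|lebesgue. h x * \<psi> k x) = integral {a..b} (\<lambda>x. h x * \<psi> k x)"
      using int by (rule lebesgue_integral_eq_integral_Icc) (auto intro!: out)
    ultimately show ?thesis using 0 by simp
  qed
  have "(\<lambda>k. integral {a..b} (\<lambda>x. h x * \<psi> k x)) \<longlonglongrightarrow> integral {a..b} (\<lambda>x. h x * indicator {a<..<b} x)"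
  proof (rule dominated_convergence)
    show "(\<lambda>x. h x * \<psi> k x) integrable_on {a..b}" for k
      using int absolutely_integrable_on_def by blast
    show "(\<lambda>x. norm (h x)) integrable_on {a..b}"
      using locally_summableD[OF h] absolutely_integrable_on_def by blast
    show "norm (h x * \<psi> k x) \<le> norm (h x)" for k x
    proof -
      have "\<bar>\<psi> k x\<bar> \<le> 1 * 1" unfolding \<psi>_def abs_mult by (intro mult_mono R) auto
      then show ?thesis by (auto simp: abs_mult intro: mult_left_le)
    qed
    show "(\<lambda>k. h x * \<psi> k x) \<longlonglongrightarrow> h x * indicator {a<..<b} x" for x
    proof (cases "x \<in> {a<..<b}")
      case True
      \<comment> \<open>The distance of \<open>x\<close> from the end points; both factors have
        reached 1 as soon as k d \<ge> 1.\<close>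
      define d where "d = min (x - a) (b - x)"
      have d: "d > 0" using True by (auto simp: d_def)
      have "\<psi> k x = 1" if "real k \<ge> 1 / d" for k
      proof -
        have "1 \<le> real k * d" using that d by (simp add: field_simps)
        also have "real k * d \<le> real k * (x - a)" "real k * d \<le> real k * (b - x)"
          by (auto simp: d_def intro!: mult_left_mono)
        ultimately have "1 \<le> real k * (x - a)" "1 \<le> real k * (b - x)" 
          by (meson order_trans)+
        then show ?thesis unfolding \<psi>_def by (simp add: R algebra_simps)
      qed
      moreover have "eventually (\<lambda>k. real k \<ge> 1 / d) sequentially"
        using filterlim_real_sequentially by (simp add: filterlim_at_top)
      ultimately have "eventually (\<lambda>k. \<psi> k x = 1) sequentially"
        by (auto elim: eventually_mono)
      then have "eventually (\<lambda>k. h x * \<psi> k x = h x * indicator {a<..<b} x) sequentially"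
        by eventually_elim (use True in simp)
      then show ?thesis by (rule tendsto_eventually)
    qed (simp add: out)
  qed
  then have "integral {a..b} (\<lambda>x. h x * indicator {a<..<b} x) = 0"
    unfolding z by (simp add: LIMSEQ_const_iff)
  moreover have "integral {a..b} (\<lambda>x. h x * indicator {a<..<b} x) = integral {a..b} h"
    by (rule integral_spike[of "{a, b}"]) (auto split: split_indicator)
  ultimately show "integral {a..b} h = 0" by simp
qed

lemma locally_summable_diff:
  "locally_summable f \<Longrightarrow> locally_summable g \<Longrightarrow> locally_summable (\<lambda>x. f x - g x)"
  by (simp add: locally_summable_def set_integral_diff)

lemma test_function_support:
  assumes "test_function \<psi>"
  obtains a b where "\<And>n x. x \<notin> {a..b} \<Longrightarrow> (deriv ^^ n) \<psi> x = 0" "a \<le> b"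
proof -
  obtain a b where ab: "\<And>x. x \<notin> {a..b} \<Longrightarrow> \<psi> x = 0"
    using assms by (auto simp: test_function_def)
  \<comment> \<open>\<open>max a b\<close> provides a nonempty interval even when
    \<open>{a..b}\<close> is empty, that is, when \<psi> vanishes identically.\<close>
  have "(deriv ^^ n) \<psi> x = 0" if "x \<notin> {a..max a b}" for n x
  proof -
    have "(deriv ^^ n) \<psi> x = (deriv ^^ n) (\<lambda>_. 0) x"
      by (rule funpow_deriv_cong_open[of "- {a..b}"]) (use ab that in auto)
    also have "(deriv ^^ n) (\<lambda>_. 0) = (\<lambda>_. 0::real)"
      by (induction n) simp_all
    finally show ?thesis .
  qed
  then show ?thesis using that[of a "max a b"] by simp
qed

text \<open>The difference of two generalized derivatives is annihilated by every test function.
  This makes the choice in \<open>weak_deriv\<close> harmless under an integral.\<close>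

lemma has_weak_deriv_AE_unique:
  assumes "has_weak_deriv n f g" "has_weak_deriv n f g'"
  shows "AE x in lebesgue. g x = g' x"
proof -
  have s: "locally_summable g" "locally_summable g'"
    using assms by (auto simp: has_weak_deriv_def)
  have "AE x in lebesgue. g x - g' x = 0"
  proof (rule du_Bois_Reymond)
    show "locally_summable (\<lambda>x. g x - g' x)" by (intro locally_summable_diff s)
    fix \<psi> assume \<psi>: "test_function \<psi>"
    then obtain a b where ab: "\<And>x. x \<notin> {a..b} \<Longrightarrow> \<psi> x = 0"
      by (auto simp: test_function_def)
    have sm: "smooth \<psi>" using \<psi> by (simp add: test_function_iff)
    have "integrable lebesgue (\<lambda>x. f x * \<psi> x)" if "locally_summable f" for f
    proof -
      have "(\<lambda>x. f x * \<psi> x) absolutely_integrable_on {a..b}"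
        by (intro locally_summable_mult_continuous that smooth_continuous_on sm)
      moreover have "(\<lambda>x. indicator {a..b} x *\<^sub>R (f x * \<psi> x)) = (\<lambda>x. f x * \<psi> x)"
        using ab by (auto simp: fun_eq_iff split: split_indicator)
      ultimately show ?thesis by (simp add: set_integrable_def)
    qed
    from Bochner_Integration.integral_diff[OF this[OF s(1)] this[OF s(2)]]
    have "(LINT x|lebesgue. (g x - g' x) * \<psi> x)
        = (LINT x|lebesgue. g x * \<psi> x) - (LINT x|lebesgue. g' x * \<psi> x)"
      by (simp only: left_diff_distrib)
    moreover have e: "(LINT x|lebesgue. f x * (deriv ^^ n) \<psi> x) = (-1) ^ n * (LINT x|lebesgue. g x * \<psi> x)"
      if "has_weak_deriv n f g" for g
      using that \<psi> unfolding has_weak_deriv_def by blast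
    have "(-1) ^ n * (LINT x|lebesgue. g x * \<psi> x) = (-1) ^ n * (LINT x|lebesgue. g' x * \<psi> x)"
      using e[OF assms(1)] e[OF assms(2)] by (rule trans[OF sym])
    ultimately show "(LINT x|lebesgue. (g x - g' x) * \<psi> x) = 0" by simp
  qed
  then show ?thesis by eventually_elim simp
qed

lemma test_function_deriv: "test_function \<psi> \<Longrightarrow> test_function (deriv \<psi>)"
proof -
  assume \<psi>: "test_function \<psi>"
  obtain a b where "\<And>n x. x \<notin> {a..b} \<Longrightarrow> (deriv ^^ n) \<psi> x = 0"
    using test_function_support[OF \<psi>] by metis
  from this[where n=1] have "\<forall>x. x \<notin> {a..b} \<longrightarrow> deriv \<psi> x = 0" by simp
  with \<psi> show ?thesis unfolding test_function_iff by (blast intro: smooth_deriv)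
qed

lemma lebesgue_integral_by_parts_test_function:
  assumes u: "smooth u" and \<psi>: "test_function \<psi>"
  shows "(LINT x|lebesgue. u x * deriv \<psi> x) = - (LINT x|lebesgue. deriv u x * \<psi> x)"
proof -
  obtain a b where ab: "\<And>n x. x \<notin> {a..b} \<Longrightarrow> (deriv ^^ n) \<psi> x = 0" "a \<le> b"
    using test_function_support[OF \<psi>] by metis
  have s\<psi>: "smooth \<psi>" using \<psi> by (simp add: test_function_iff)
  have z: "\<psi> x = 0" "deriv \<psi> x = 0" if "x \<notin> {a - 1..b + 1}" for x
    using ab(1)[of x 0] ab(1)[of x 1] that by auto
  \<comment> \<open>Enlarging the support interval by 1 on each side makes \<psi> vanish at the end
    points, so there are no boundary terms.\<close>
  let ?I = "{a - 1..b + 1}"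
  have i1: "(\<lambda>x. u x * deriv \<psi> x) absolutely_integrable_on ?I"
    and i2: "(\<lambda>x. deriv u x * \<psi> x) absolutely_integrable_on ?I"
    by (intro absolutely_integrable_continuous_real continuous_on_mult smooth_continuous_on
        smooth_deriv u s\<psi>)+
  have "((\<lambda>x. u x * deriv \<psi> x + deriv u x * \<psi> x) has_integral u (b + 1) * \<psi> (b + 1) - u (a - 1) * \<psi> (a - 1)) ?I"
  proof (rule fundamental_theorem_of_calculus)
    fix x
    show "((\<lambda>x. u x * \<psi> x) has_vector_derivative u x * deriv \<psi> x + deriv u x * \<psi> x) (at x within ?I)"
      using DERIV_mult'[OF smooth_DERIV[OF u] smooth_DERIV[OF s\<psi>]]
      by (auto simp: has_real_derivative_iff_has_vector_derivative intro: has_vector_derivative_at_within)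
  qed (use ab(2) in simp)
  moreover have "\<psi> (b + 1) = 0" "\<psi> (a - 1) = 0"
    using ab(1)[of "b + 1" 0] ab(1)[of "a - 1" 0] by auto
  ultimately have "integral ?I (\<lambda>x. u x * deriv \<psi> x + deriv u x * \<psi> x) = 0"
    by (simp add: integral_unique)
  moreover have "integral ?I (\<lambda>x. u x * deriv \<psi> x + deriv u x * \<psi> x)
      = integral ?I (\<lambda>x. u x * deriv \<psi> x) + integral ?I (\<lambda>x. deriv u x * \<psi> x)"
    using i1 i2 by (intro Henstock_Kurzweil_Integration.integral_add) (auto simp: absolutely_integrable_on_def)
  moreover have "(LINT x|lebesgue. u x * deriv \<psi> x) = integral ?I (\<lambda>x. u x * deriv \<psi> x)"
    by (rule lebesgue_integral_eq_integral_Icc[OF i1]) (simp add: z(2))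
  moreover have "(LINT x|lebesgue. deriv u x * \<psi> x) = integral ?I (\<lambda>x. deriv u x * \<psi> x)"
    by (rule lebesgue_integral_eq_integral_Icc[OF i2]) (simp add: z(1))
  ultimately show ?thesis by linarith
qed

lemma smooth_has_weak_deriv:
  assumes u: "smooth u"
  shows "has_weak_deriv n u ((deriv ^^ n) u)"
proof -
  have "(LINT x|lebesgue. u x * (deriv ^^ n) \<psi> x) = (-1) ^ n * (LINT x|lebesgue. (deriv ^^ n) u x * \<psi> x)"
    if "test_function \<psi>" for \<psi>
    using that
  proof (induction n arbitrary: \<psi>)
    case (Suc n)
    have "(LINT x|lebesgue. u x * (deriv ^^ Suc n) \<psi> x) = (LINT x|lebesgue. u x * (deriv ^^ n) (deriv \<psi>) x)"
      by (simp add: funpow_swap1)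
    also have "\<dots> = (-1) ^ n * (LINT x|lebesgue. (deriv ^^ n) u x * deriv \<psi> x)"
      by (intro Suc.IH test_function_deriv Suc.prems)
    also have "\<dots> = (-1) ^ Suc n * (LINT x|lebesgue. (deriv ^^ Suc n) u x * \<psi> x)"
      using lebesgue_integral_by_parts_test_function[OF smooth_funpow_deriv[OF u] Suc.prems] by simp
    finally show ?case .
  qed simp
  then show ?thesis
    unfolding has_weak_deriv_def
    by (intro conjI continuous_locally_summable smooth_continuous_on smooth_funpow_deriv u) blast
qed

section \<open>Generalized derivatives of periodic functions\<close>

lemma locally_summable_shift:
  assumes "locally_summable g"
  shows "locally_summable (\<lambda>x. g (1 + x))"
  unfolding locally_summable_def
proof (intro allI)
  fix a b
  have "integrable lebesgue (\<lambda>x. indicator {1 + a..1 + b} x *\<^sub>R g x)"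
    using locally_summableD[OF assms] by (simp add: set_integrable_def)
  then have "integrable lebesgue (\<lambda>x. indicator {1 + a..1 + b} (1 + 1 * x) *\<^sub>R g (1 + 1 * x))"
    by (rule lebesgue_integrable_real_affine) simp
  moreover have "(\<lambda>x. indicator {1 + a..1 + b} (1 + 1 * x) *\<^sub>R g (1 + 1 * x))
      = (\<lambda>x. indicator {a..b} x *\<^sub>R g (1 + x))"
    by (auto simp: fun_eq_iff split: split_indicator)
  ultimately show "(\<lambda>x. g (1 + x)) absolutely_integrable_on {a..b}"
    by (simp add: set_integrable_def)
qed

text \<open>Translating test functions shows that the translate of \<open>g\<close> is a generalized
  derivative of the translate of \<open>f\<close>, which is \<open>f\<close> itself; uniqueness does
  the rest.\<close>

lemma has_weak_deriv_periodic:
  assumes w: "has_weak_deriv n f g" and per: "\<And>x. f (x + 1) = f x"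
  shows "AE x in lebesgue. g (1 + x) = g x"
proof (rule has_weak_deriv_AE_unique[OF _ w])
  have "(LINT x|lebesgue. f x * (deriv ^^ n) \<psi> x) = (-1) ^ n * (LINT x|lebesgue. g (1 + x) * \<psi> x)"
    if \<psi>: "test_function \<psi>" for \<psi>
  proof -
    have s: "smooth \<psi>" using \<psi> by (simp add: test_function_iff)
    let ?p = "\<lambda>x. \<psi> (x + (-1))"
    obtain a b where ab: "\<forall>x. x \<notin> {a..b} \<longrightarrow> \<psi> x = 0"
      using \<psi> by (auto simp: test_function_iff)
    have "smooth ?p"
      using smooth_affine[OF s, of 1 "-1"] by simp
    moreover have "\<forall>x. x \<notin> {a + 1..b + 1} \<longrightarrow> ?p x = 0"
      using ab by auto
    ultimately have "test_function ?p"
      unfolding test_function_iff by blast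
    then have "(LINT x|lebesgue. f x * (deriv ^^ n) ?p x) = (-1) ^ n * (LINT x|lebesgue. g x * ?p x)"
      using w unfolding has_weak_deriv_def by blast
    moreover have "(LINT x|lebesgue. f x * (deriv ^^ n) ?p x)
        = (LINT x|lebesgue. f (1 + x) * (deriv ^^ n) \<psi> x)"
      unfolding deriv_shift_funpow[OF s]
      using lebesgue_integral_real_affine[of 1 "\<lambda>x. f x * (deriv ^^ n) \<psi> (x + -1)" 1] by simp
    moreover have "(LINT x|lebesgue. g x * ?p x) = (LINT x|lebesgue. g (1 + x) * \<psi> x)"
      using lebesgue_integral_real_affine[of 1 "\<lambda>x. g x * ?p x" 1] by simp
    ultimately show ?thesis using per by (simp add: add.commute)
  qed
  then show "has_weak_deriv n f (\<lambda>x. g (1 + x))"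
    using w locally_summable_shift[of g] unfolding has_weak_deriv_def by simp
qed

lemma AE_lebesgue_negligible:
  assumes "AE x in lebesgue. P x"
  obtains N where "negligible N" "\<And>x. x \<notin> N \<Longrightarrow> P x"
proof -
  obtain N where "N \<in> null_sets lebesgue" "{x \<in> space lebesgue. \<not> P x} \<subseteq> N"
    using assms unfolding eventually_ae_filter by blast
  then show ?thesis by (intro that[of N]) (auto simp: negligible_iff_null_sets)
qed

text \<open>A period of the integrand \<open>f P\<close> is unfolded to the line by means of the cut-off version
  \<open>Q\<close> of \<open>P\<close>: the integer translates of \<open>Q x - Q (x - 1)\<close> sum to \<open>P\<close>.\<close>
lemma lebesgue_integral_unfold_period:
  fixes f P Q :: "real \<Rightarrow> real"
  assumes f: "locally_summable f" and fper: "AE x in lebesgue. f (1 + x) = f x"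
    and Q: "continuous_on UNIV Q" and Q0: "\<And>x. x \<le> 0 \<Longrightarrow> Q x = 0" and QP: "\<And>x. x \<ge> 1 \<Longrightarrow> Q x = P x"
    and Pper: "\<And>x. P (x + 1) = P x"
  shows "(LINT x|lebesgue. f x * (Q x - Q (x - 1))) = integral {0..1} (\<lambda>x. f x * P x)"
proof -
  obtain N where N: "negligible N" "\<And>x. x \<notin> N \<Longrightarrow> f (1 + x) = f x"
    using AE_lebesgue_negligible[OF fper] by metis
  have shift: "integral {1..2} (\<lambda>x. f x * H x) = integral {0..1} (\<lambda>x. f x * H (1 + x))" for H
  proof -
    have "integral {1..2} (\<lambda>x. f x * H x) = integral {0..1} (\<lambda>x. f (1 + x) * H (1 + x))"
      using integral_shift_Icc_real[of 0 1 "\<lambda>x. f x * H x" 1] by (simp add: o_def)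
    also have "\<dots> = integral {0..1} (\<lambda>x. f x * H (1 + x))"
      by (rule integral_spike[OF N(1)]) (simp add: N(2))
    finally show ?thesis .
  qed
  have Q1: "continuous_on UNIV (\<lambda>x. Q (x - 1))"
    by (rule continuous_on_compose2[OF Q]) (auto intro!: continuous_intros)
  have a: "(\<lambda>x. f x * Q x) absolutely_integrable_on {a..b}"
    "(\<lambda>x. f x * Q (x - 1)) absolutely_integrable_on {a..b}"
    "(\<lambda>x. f x * (Q x - Q (x - 1))) absolutely_integrable_on {a..b}" for a b
    by (intro locally_summable_mult_continuous f continuous_on_diff;
        use Q Q1 in \<open>blast intro: continuous_on_subset\<close>)+
  then have i: "(\<lambda>x. f x * Q x) integrable_on {a..b}"
    "(\<lambda>x. f x * Q (x - 1)) integrable_on {a..b}" for a b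
    by (auto simp: absolutely_integrable_on_def)
  have "(LINT x|lebesgue. f x * (Q x - Q (x - 1))) = integral {0..2} (\<lambda>x. f x * (Q x - Q (x - 1)))"
  proof (rule lebesgue_integral_eq_integral_Icc[OF a(3)])
    fix x :: real assume "x \<notin> {0..2}"
    then consider "x < 0" | "x > 2" by force
    then show "f x * (Q x - Q (x - 1)) = 0"
    proof cases
      case 2
      then show ?thesis using QP[of x] QP[of "x - 1"] Pper[of "x - 1"] by simp
    qed (simp add: Q0)
  qed
  \<comment> \<open>The factor is Q(x) on \<open>{0..1}\<close> and P(x) - Q(x - 1) on
    \<open>{1..2}\<close>. Moving the second interval back by one cancels the two integrals of f Q
    and leaves that of f P.\<close>
  also have "\<dots> = integral {0..2} (\<lambda>x. f x * Q x) - integral {0..2} (\<lambda>x. f x * Q (x - 1))"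
    by (simp add: right_diff_distrib Henstock_Kurzweil_Integration.integral_diff i)
  also have "integral {0..2} (\<lambda>x. f x * Q x)
      = integral {0..1} (\<lambda>x. f x * Q x) + integral {1..2} (\<lambda>x. f x * Q x)"
    by (rule Henstock_Kurzweil_Integration.integral_combine[symmetric]) (auto intro: i)
  also have "integral {0..2} (\<lambda>x. f x * Q (x - 1))
      = integral {0..1} (\<lambda>x. f x * Q (x - 1)) + integral {1..2} (\<lambda>x. f x * Q (x - 1))"
    by (rule Henstock_Kurzweil_Integration.integral_combine[symmetric]) (auto intro: i)
  also have "integral {0..1} (\<lambda>x. f x * Q (x - 1)) = integral {0..1} (\<lambda>_::real. 0)"
    by (rule Henstock_Kurzweil_Integration.integral_cong) (simp add: Q0)
  also have "integral {1..2} (\<lambda>x. f x * Q (x - 1)) = integral {0..1} (\<lambda>x. f x * Q x)"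
    by (subst shift) simp
  also have "integral {1..2} (\<lambda>x. f x * Q x) = integral {0..1} (\<lambda>x. f x * Q (1 + x))"
    by (rule shift)
  also have "\<dots> = integral {0..1} (\<lambda>x. f x * P x)"
    by (rule Henstock_Kurzweil_Integration.integral_cong) (simp add: QP Pper add.commute)
  finally show ?thesis by simp
qed

text \<open>Integration by parts over a period without boundary terms: both sides of the defining
  identity, tested with the difference of \<open>Q\<close> and its translate, fold to one period. On
  the right this uses that \<open>g\<close> is periodic almost everywhere.\<close>

lemma has_weak_deriv_integral_period:
  assumes w: "has_weak_deriv n f g" and fper: "\<And>x. f (x + 1) = f x"
    and \<psi>: "smooth \<psi>" and \<psi>per: "\<And>x. \<psi> (x + 1) = \<psi> x"
  shows "integral {0..1} (\<lambda>x. f x * (deriv ^^ n) \<psi> x) = (-1) ^ n * integral {0..1} (\<lambda>x. g x * \<psi> x)"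
proof -
  obtain R where R: "smooth R" "\<And>x. x \<le> 0 \<Longrightarrow> R x = 0" "\<And>x. x \<ge> 1 \<Longrightarrow> R x = 1"
    using smooth_step_exists by metis
  \<comment> \<open>The cut-off is 0 up to 1/4 and 1 from 3/4 on. The margins let \<open>Q\<close>
    agree with 0 and with \<psi> on open sets containing all x \<le> 0 and all x \<ge> 1, hence with
    all derivatives.\<close>
  define Q where "Q x = \<psi> x * R (2 * x + (- 1 / 2))" for x
  have sQ: "smooth Q" unfolding Q_def by (intro smooth_mult \<psi> smooth_affine R)
  have sQ1: "smooth (\<lambda>x. Q (x - 1))"
    using smooth_affine[OF sQ, of 1 "-1"] by simp
  have D0: "(deriv ^^ k) Q x = 0" if "x \<le> 0" for k x
  proof -
    have "(deriv ^^ k) Q x = (deriv ^^ k) (\<lambda>_. 0) x"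
      by (rule funpow_deriv_cong_open[of "{..<1/4}"]) (use that in \<open>auto simp: Q_def R\<close>)
    also have "(deriv ^^ k) (\<lambda>_. 0) = (\<lambda>_. 0::real)"
      by (induction k) simp_all
    finally show ?thesis .
  qed
  have D1: "(deriv ^^ k) Q x = (deriv ^^ k) \<psi> x" if "x \<ge> 1" for k x
    by (rule funpow_deriv_cong_open[of "{3/4<..}"]) (use that in \<open>auto simp: Q_def R\<close>)
  have Dper: "(deriv ^^ k) \<psi> (x + 1) = (deriv ^^ k) \<psi> x" for k x
    using fun_cong[OF deriv_shift_funpow[OF \<psi>, of k 1], of x] by (simp add: \<psi>per)
  have unfold: "(LINT x|lebesgue. h x * ((deriv ^^ k) Q x - (deriv ^^ k) Q (x - 1)))
      = integral {0..1} (\<lambda>x. h x * (deriv ^^ k) \<psi> x)"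
    if "locally_summable h" "AE x in lebesgue. h (1 + x) = h x" for h k
    by (rule lebesgue_integral_unfold_period[OF that])
      (use D0 D1 Dper in \<open>auto intro: smooth_continuous_on smooth_funpow_deriv sQ\<close>)
  let ?q = "\<lambda>x. Q x - Q (x - 1)"
  have "test_function ?q"
    unfolding test_function_iff
  proof (intro conjI exI allI impI)
    show "smooth ?q" by (intro smooth_diff sQ sQ1)
    fix x :: real assume "x \<notin> {0..2}"
    then consider "x < 0" | "x > 2" by force
    then show "?q x = 0"
    proof cases
      case 1
      then show ?thesis using D0[of x 0] D0[of "x - 1" 0] by simp
    next
      case 2
      then show ?thesis using D1[of x 0] D1[of "x - 1" 0] \<psi>per[of "x - 1"] by simp
    qed
  qed
  then have "(LINT x|lebesgue. f x * (deriv ^^ n) ?q x) = (-1) ^ n * (LINT x|lebesgue. g x * ?q x)"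
    using w unfolding has_weak_deriv_def by blast
  moreover have "(deriv ^^ n) ?q = (\<lambda>x. (deriv ^^ n) Q x - (deriv ^^ n) Q (x - 1))"
    using deriv_diff_funpow[OF sQ sQ1, of n] deriv_shift_funpow[OF sQ, of n "-1"] by simp
  moreover have "(LINT x|lebesgue. f x * ((deriv ^^ n) Q x - (deriv ^^ n) Q (x - 1)))
      = integral {0..1} (\<lambda>x. f x * (deriv ^^ n) \<psi> x)"
    by (rule unfold) (use w fper in \<open>auto simp: has_weak_deriv_def add.commute\<close>)
  moreover have "(LINT x|lebesgue. g x * ?q x) = integral {0..1} (\<lambda>x. g x * \<psi> x)"
    using unfold[of g 0] w has_weak_deriv_periodic[OF w fper] by (simp add: has_weak_deriv_def)
  ultimately show ?thesis by simp
qed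

section \<open>Trigonometric polynomials\<close>

text \<open>The constant mode is left out so that antiderivatives stay in the class.\<close>

definition trig :: "nat \<Rightarrow> (nat \<Rightarrow> real) \<Rightarrow> (nat \<Rightarrow> real) \<Rightarrow> real \<Rightarrow> real" where
  "trig K a b x = (\<Sum>n=1..K. a n * cos (2 * pi * n * x) + b n * sin (2 * pi * n * x))"

lemma smooth_trig: "smooth (trig K a b)"
proof -
  have "smooth (\<lambda>x. \<Sum>n=1..K. a n * cos (2 * pi * n * x + 0) + b n * sin (2 * pi * n * x + 0))"
    by (intro smooth_sum smooth_add smooth_mult smooth_const smooth_affine smooth_sin_cos)
  then show ?thesis by (simp add: trig_def[abs_def])
qed

lemma cos_sin_2pi_periodic:
  fixes n :: nat and x :: real
  shows "cos (2 * pi * n * (x + 1)) = cos (2 * pi * n * x)"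
    and "sin (2 * pi * n * (x + 1)) = sin (2 * pi * n * x)"
proof -
  have "2 * pi * n * (x + 1) = 2 * pi * n * x + 2 * pi * n" by (simp add: algebra_simps)
  moreover have "cos (2 * pi * n) = 1" "sin (2 * pi * n) = 0"
    using cos_int_2pin[of "int n"] sin_int_2pin[of "int n"] by simp_all
  ultimately show "cos (2 * pi * n * (x + 1)) = cos (2 * pi * n * x)"
    "sin (2 * pi * n * (x + 1)) = sin (2 * pi * n * x)"
    by (simp_all add: cos_add sin_add)
qed

lemma trig_periodic: "trig K a b (x + 1) = trig K a b x"
  by (simp only: trig_def cos_sin_2pi_periodic)

lemma deriv_trig: "deriv (trig K a b) = trig K (\<lambda>n. 2 * pi * n * b n) (\<lambda>n. - (2 * pi * n * a n))"
proof
  fix x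
  have "(trig K a b has_real_derivative
      (\<Sum>n=1..K. a n * (- sin (2 * pi * n * x) * (2 * pi * n)) + b n * (cos (2 * pi * n * x) * (2 * pi * n)))) (at x)"
    unfolding trig_def[abs_def]
    by (intro DERIV_sum DERIV_add DERIV_cmult) (auto intro!: derivative_eq_intros)
  also have "(\<Sum>n=1..K. a n * (- sin (2 * pi * n * x) * (2 * pi * n)) + b n * (cos (2 * pi * n * x) * (2 * pi * n)))
      = trig K (\<lambda>n. 2 * pi * n * b n) (\<lambda>n. - (2 * pi * n * a n)) x"
    unfolding trig_def by (intro sum.cong) (simp_all add: algebra_simps)
  finally show "deriv (trig K a b) x = trig K (\<lambda>n. 2 * pi * n * b n) (\<lambda>n. - (2 * pi * n * a n)) x"
    by (rule DERIV_imp_deriv)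
qed

text \<open>Each antidifferentiation divides the amplitude at frequency \<open>n\<close> by 2 pi n
  and rotates the coefficient pair by a quarter turn. Only the amplitude is recorded, since it alone
  enters the L2 norm.\<close>

lemma trig_funpow_antideriv:
  "\<exists>a' b'. (deriv ^^ m) (trig K a' b') = trig K a b
    \<and> (\<forall>n\<in>{1..K}. (a' n)\<^sup>2 + (b' n)\<^sup>2 = ((a n)\<^sup>2 + (b n)\<^sup>2) / (2 * pi * n) ^ (2 * m))"
proof (induction m arbitrary: a b)
  case 0
  show ?case by (intro exI[of _ a] exI[of _ b]) simp
next
  case (Suc m)
  define a1 b1 where "a1 n = - b n / (2 * pi * real n)" and "b1 n = a n / (2 * pi * real n)" for n
  obtain a' b' where IH: "(deriv ^^ m) (trig K a' b') = trig K a1 b1"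
    "\<And>n. n \<in> {1..K} \<Longrightarrow> (a' n)\<^sup>2 + (b' n)\<^sup>2 = ((a1 n)\<^sup>2 + (b1 n)\<^sup>2) / (2 * pi * n) ^ (2 * m)"
    using Suc.IH by metis
  have "deriv (trig K a1 b1) = trig K a b"
    unfolding deriv_trig by (simp add: trig_def fun_eq_iff a1_def b1_def)
  moreover have "(a' n)\<^sup>2 + (b' n)\<^sup>2 = ((a n)\<^sup>2 + (b n)\<^sup>2) / (2 * pi * n) ^ (2 * Suc m)"
    if "n \<in> {1..K}" for n
  proof -
    have "(a1 n)\<^sup>2 + (b1 n)\<^sup>2 = ((a n)\<^sup>2 + (b n)\<^sup>2) / (2 * pi * n)\<^sup>2"
      by (simp add: a1_def b1_def power_divide add_divide_distrib)
    then show ?thesis unfolding IH(2)[OF that] by (simp add: power2_eq_square)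
  qed
  ultimately show ?case using IH(1) by (intro exI[of _ a'] exI[of _ b']) simp
qed

section \<open>Orthogonality and Parseval's identity\<close>

lemma has_integral_cos_period:
  "((\<lambda>x. cos (2 * pi * of_int j * x)) has_integral (if j = 0 then 1 else 0)) {0..1::real}"
proof (cases "j = 0")
  case True
  then show ?thesis using has_integral_const_real[of "1::real" 0 1] by simp
next
  case False
  have "((\<lambda>x. cos (2 * pi * of_int j * x)) has_integral
      (sin (2 * pi * of_int j * 1) / (2 * pi * of_int j) - sin (2 * pi * of_int j * 0) / (2 * pi * of_int j))) {0..1::real}"
    by (rule fundamental_theorem_of_calculus)
       (use False in \<open>auto intro!: derivative_eq_intros
          simp flip: has_real_derivative_iff_has_vector_derivative\<close>)
  then show ?thesis using False by (simp add: sin_int_2pin)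
qed

lemma has_integral_sin_period:
  "((\<lambda>x. sin (2 * pi * of_int j * x)) has_integral 0) {0..1::real}"
proof (cases "j = 0")
  case False
  have "((\<lambda>x. sin (2 * pi * of_int j * x)) has_integral
      (- cos (2 * pi * of_int j * 1) / (2 * pi * of_int j) - - cos (2 * pi * of_int j * 0) / (2 * pi * of_int j))) {0..1::real}"
    by (rule fundamental_theorem_of_calculus)
       (use False in \<open>auto intro!: derivative_eq_intros
          simp flip: has_real_derivative_iff_has_vector_derivative\<close>)
  then show ?thesis using False by (simp add: cos_int_2pin)
qed simp

lemma has_integral_trig: "(trig K a b has_integral 0) {0..1}"
proof -
  have "((\<lambda>x. a n * cos (2 * pi * n * x) + b n * sin (2 * pi * n * x)) has_integral a n * 0 + b n * 0) {0..1}"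
    if "n \<in> {1..K}" for n
    using has_integral_cos_period[of "int n"] has_integral_sin_period[of "int n"] that
    by (intro has_integral_add has_integral_mult_right) auto
  then have "((\<lambda>x. \<Sum>n=1..K. a n * cos (2 * pi * n * x) + b n * sin (2 * pi * n * x))
      has_integral (\<Sum>n=1..K. a n * 0 + b n * 0)) {0..1}"
    by (intro has_integral_sum) auto
  then show ?thesis by (simp add: trig_def[abs_def])
qed

text \<open>Only the frequencies n - k and n + k occur in the product; positivity excludes n + k =
  0. Frequencies are integers because n - k may be negative.\<close>

lemma has_integral_trig_product:
  fixes n k :: nat
  assumes "n \<ge> 1" "k \<ge> 1"
  shows "((\<lambda>x. (a * cos (2 * pi * n * x) + b * sin (2 * pi * n * x)) * (c * cos (2 * pi * k * x) + d * sin (2 * pi * k * x)))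
    has_integral (if n = k then (a * c + b * d) / 2 else 0)) {0..1}"
proof -
  let ?m = "int n - int k" and ?p = "int n + int k"
  let ?C = "\<lambda>j x. cos (2 * pi * of_int j * x)" and ?S = "\<lambda>j x. sin (2 * pi * of_int j * x)"
  have "((\<lambda>x. (a * c + b * d) / 2 * ?C ?m x + (a * c - b * d) / 2 * ?C ?p x
      + (b * c - a * d) / 2 * ?S ?m x + (b * c + a * d) / 2 * ?S ?p x) has_integral
      (a * c + b * d) / 2 * (if ?m = 0 then 1 else 0) + (a * c - b * d) / 2 * (if ?p = 0 then 1 else 0)
      + (b * c - a * d) / 2 * 0 + (b * c + a * d) / 2 * 0) {0..1}"
    by (intro has_integral_add has_integral_mult_right has_integral_cos_period has_integral_sin_period)
  moreover have "(a * c + b * d) / 2 * ?C ?m x + (a * c - b * d) / 2 * ?C ?p x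
      + (b * c - a * d) / 2 * ?S ?m x + (b * c + a * d) / 2 * ?S ?p x
    = (a * cos (2 * pi * n * x) + b * sin (2 * pi * n * x)) * (c * cos (2 * pi * k * x) + d * sin (2 * pi * k * x))" for x
  proof -
    have e: "2 * pi * of_int ?m * x = 2 * pi * n * x - 2 * pi * k * x"
      "2 * pi * of_int ?p * x = 2 * pi * n * x + 2 * pi * k * x" by (simp_all add: algebra_simps)
    show ?thesis
      unfolding e cos_add cos_diff sin_add sin_diff by (simp add: field_simps)
  qed
  moreover have "?m = 0 \<longleftrightarrow> n = k" "?p \<noteq> 0" using assms by auto
  ultimately show ?thesis by (auto split: if_splits)
qed

lemma has_integral_trig_square:
  "((\<lambda>x. (trig K a b x)\<^sup>2) has_integral (\<Sum>n=1..K. ((a n)\<^sup>2 + (b n)\<^sup>2) / 2)) {0..1}"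
proof -
  let ?t = "\<lambda>n x. a n * cos (2 * pi * n * x) + b n * sin (2 * pi * n * x)"
  have "((\<lambda>x. \<Sum>n=1..K. \<Sum>k=1..K. ?t n x * ?t k x) has_integral
      (\<Sum>n=1..K. \<Sum>k=1..K. if n = k then (a n * a k + b n * b k) / 2 else 0)) {0..1}"
    by (intro has_integral_sum has_integral_trig_product) auto
  then show ?thesis
    by (simp add: trig_def power2_eq_square sum_product)
qed

lemma has_integral_trig_deriv_square:
  "((\<lambda>x. ((deriv ^^ m) (trig K a b) x)\<^sup>2) has_integral
    (\<Sum>n=1..K. (2 * pi * n) ^ (2 * m) * ((a n)\<^sup>2 + (b n)\<^sup>2) / 2)) {0..1}"
proof (induction m arbitrary: a b)
  case 0
  then show ?case using has_integral_trig_square by simp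
next
  case (Suc m)
  have "(2 * pi * n) ^ (2 * m) * ((2 * pi * n * b n)\<^sup>2 + (- (2 * pi * n * a n))\<^sup>2)
      = (2 * pi * n) ^ (2 * Suc m) * ((a n)\<^sup>2 + (b n)\<^sup>2)" for n
    by (simp add: power_mult_distrib power2_eq_square algebra_simps)
  then show ?case
    using Suc[of "\<lambda>n. 2 * pi * n * b n" "\<lambda>n. - (2 * pi * n * a n)"]
    by (simp add: funpow_swap1 deriv_trig del: power_Suc mult_Suc_right)
qed

section \<open>Fejer's theorem\<close>

text \<open>The Fejer kernel of period 1: the weights come from averaging the Dirichlet kernels of
  orders 0 to \<open>K\<close>.\<close>

definition fejer :: "nat \<Rightarrow> real \<Rightarrow> real" where
  "fejer K t = 1 + (\<Sum>n=1..K. 2 * (1 - real n / real (Suc K)) * cos (2 * pi * real n * t))"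

lemma sin_times_dirichlet:
  "sin (pi * t) * (1 + 2 * (\<Sum>n=1..K. cos (2 * pi * real n * t))) = sin ((2 * K + 1) * (pi * t))"
proof (induction K)
  case (Suc K)
  have e: "(2 * real (Suc K) + 1) * (pi * t) = 2 * pi * real (Suc K) * t + pi * t"
    "(2 * real K + 1) * (pi * t) = 2 * pi * real (Suc K) * t - pi * t"
    by (simp_all add: algebra_simps)
  have "sin (pi * t) * (1 + 2 * (\<Sum>n=1..Suc K. cos (2 * pi * real n * t)))
      = sin ((2 * real K + 1) * (pi * t)) + 2 * sin (pi * t) * cos (2 * pi * real (Suc K) * t)"
    using Suc.IH by (simp add: algebra_simps)
  also have "\<dots> = sin ((2 * real (Suc K) + 1) * (pi * t))"
    unfolding e sin_add sin_diff by simp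
  finally show ?case by simp
qed simp

lemma Suc_times_fejer:
  "real (Suc K) * fejer K t = Suc K + 2 * (\<Sum>n=1..K. (real (Suc K) - real n) * cos (2 * pi * real n * t))"
proof -
  have eq: "real (Suc K) * (2 * (1 - real n / real (Suc K)) * cos (2 * pi * real n * t))
      = 2 * ((real (Suc K) - real n) * cos (2 * pi * real n * t))" for n
    by (simp add: field_simps)
  then show ?thesis
    by (simp only: fejer_def distrib_left sum_distrib_left eq mult_1_right)
qed

text \<open>The classical quotient, multiplied out so that no zero of the sine needs care. It gives
  both the positivity of the kernel and its decay like 1/(K + 1) away from the integers.\<close>

lemma fejer_times_sin_square:
  "real (Suc K) * fejer K t * (sin (pi * t))\<^sup>2 = (sin (Suc K * (pi * t)))\<^sup>2"
  unfolding Suc_times_fejer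
proof (induction K)
  case (Suc K)
  let ?s = "sin (pi * t)" and ?D = "1 + 2 * (\<Sum>n=1..Suc K. cos (2 * pi * real n * t))"
  \<comment> \<open>The term n = K + 1 of the first sum on the right has weight zero, so raising
    \<open>K\<close> by one adds exactly one Dirichlet kernel.\<close>
  have "(\<Sum>n=1..Suc K. (real (Suc (Suc K)) - real n) * cos (2 * pi * real n * t))
      = (\<Sum>n=1..Suc K. (real (Suc K) - real n) * cos (2 * pi * real n * t)) + (\<Sum>n=1..Suc K. cos (2 * pi * real n * t))"
    by (simp add: sum.distrib[symmetric] algebra_simps)
  then have "(real (Suc (Suc K)) + 2 * (\<Sum>n=1..Suc K. (real (Suc (Suc K)) - real n) * cos (2 * pi * real n * t))) * ?s\<^sup>2
      = (real (Suc K) + 2 * (\<Sum>n=1..K. (real (Suc K) - real n) * cos (2 * pi * real n * t))) * ?s\<^sup>2 + ?s * (?s * ?D)"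
    by (simp add: algebra_simps power2_eq_square)
  also have "\<dots> = (sin (Suc K * (pi * t)))\<^sup>2 + ?s * sin ((2 * real (Suc K) + 1) * (pi * t))"
    unfolding Suc.IH sin_times_dirichlet ..
  also have "\<dots> = (sin (Suc (Suc K) * (pi * t)))\<^sup>2"
  proof -
    define u where "u = real (Suc K) * (pi * t)"
    have e: "(2 * real (Suc K) + 1) * (pi * t) = (u + pi * t) + u" "real (Suc (Suc K)) * (pi * t) = u + pi * t"
      by (simp_all add: u_def algebra_simps)
    have "(sin u)\<^sup>2 + sin p * sin ((u + p) + u) = (sin (u + p))\<^sup>2" for p
    proof -
      have "sin p = sin ((u + p) - u)" by simp
      then have "sin p * sin ((u + p) + u) = (sin (u + p))\<^sup>2 * (cos u)\<^sup>2 - (cos (u + p))\<^sup>2 * (sin u)\<^sup>2"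
        by (simp only: sin_add[of "u + p" u] sin_diff) (simp add: power2_eq_square algebra_simps)
      then show ?thesis
        by (simp only: cos_squared_eq) (simp add: algebra_simps)
    qed
    from this[of "pi * t"] show ?thesis
      unfolding e by (simp add: u_def)
  qed
  finally show ?case by simp
qed simp

lemma fejer_nonneg: "fejer K t \<ge> 0"
proof (cases "sin (pi * t) = 0")
  \<comment> \<open>At integers the product identity says nothing, but all cosines are 1 and all
    weights are nonnegative.\<close>
  case True
  then obtain i :: int where "pi * t = of_int i * pi"
    unfolding sin_zero_iff_int2 by blast
  then have t: "t = of_int i" by simp
  have "cos (2 * pi * real n * t) = 1" for n :: nat
  proof -
    have "2 * pi * real n * t = 2 * pi * of_int (int n * i)" by (simp add: t)
    then show ?thesis by (simp only: cos_int_2pin)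
  qed
  then show ?thesis
    unfolding fejer_def by (intro add_nonneg_nonneg sum_nonneg) (auto simp: field_simps)
next
  case False
  have "real (Suc K) * fejer K t * (sin (pi * t))\<^sup>2 \<ge> 0"
    unfolding fejer_times_sin_square by simp
  then have "0 \<le> (real (Suc K) * (sin (pi * t))\<^sup>2) * fejer K t"
    by (simp only: mult_ac)
  moreover have "real (Suc K) * (sin (pi * t))\<^sup>2 > 0"
    using False by simp
  ultimately show ?thesis by (simp only: zero_le_mult_iff) linarith
qed

lemma periodic_add_of_int:
  fixes f :: "real \<Rightarrow> 'a"
  assumes "\<And>x. f (x + 1) = f x"
  shows "f (x + of_int k) = f x"
proof -
  have n: "f (x + real n) = f x" for n x
  proof (induction n)
    case (Suc n)
    then show ?case using assms[of "x + real n"] by (simp add: add_ac)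
  qed simp
  show ?thesis
  proof (cases "k \<ge> 0")
    case True
    then show ?thesis using n[of x "nat k"] by simp
  next
    case False
    then show ?thesis using n[of "x + of_int k" "nat (- k)"] by simp
  qed
qed

text \<open>The modulus of continuity is put in a form that can be integrated against the Fejer kernel
  without splitting the domain.\<close>
lemma continuous_periodic_oscillation:
  fixes \<phi> :: "real \<Rightarrow> real"
  assumes cont: "continuous_on UNIV \<phi>" and per: "\<And>x. \<phi> (x + 1) = \<phi> x" and e: "e > 0"
  obtains M where "M \<ge> 0" "\<And>x. \<bar>\<phi> x - \<phi> y\<bar> \<le> e + M * (sin (pi * (y - x)))\<^sup>2"
proof -
  have "isCont \<phi> y" using cont by (simp add: continuous_on_eq_continuous_at)
  then obtain d0 where d0: "d0 > 0" "\<And>x. \<bar>x - y\<bar> < d0 \<Longrightarrow> \<bar>\<phi> x - \<phi> y\<bar> < e"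
    using e unfolding continuous_at_eps_delta dist_real_def by blast
  \<comment> \<open>With d \<le> 1/2 the function sin(pi t) is increasing from t = d to t = 1/2,
    hence at least sin(pi d) there.\<close>
  define d where "d = min d0 (1/2)"
  have d: "0 < d" "d \<le> 1/2" "\<And>x. \<bar>x - y\<bar> < d \<Longrightarrow> \<bar>\<phi> x - \<phi> y\<bar> < e"
    using d0 by (auto simp: d_def)
  have "bounded (\<phi> ` {y - 1..y + 1})"
    by (intro compact_imp_bounded compact_continuous_image continuous_on_subset[OF cont]) auto
  then obtain B where "\<forall>v\<in>\<phi> ` {y - 1..y + 1}. norm v \<le> B"
    unfolding bounded_iff by blast
  then have B: "\<And>x. x \<in> {y - 1..y + 1} \<Longrightarrow> \<bar>\<phi> x\<bar> \<le> B" by simp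
  define s where "s = (sin (pi * d))\<^sup>2"
  have spos: "sin (pi * d) > 0" using d by (intro sin_gt_zero) (auto simp: field_simps)
  have s: "s > 0" using spos by (simp add: s_def)
  have B0: "B \<ge> 0" using B[of y] by simp
  show ?thesis
  proof
    \<comment> \<open>Away from \<open>y\<close> modulo 1 the squared sine is at least
      \<open>s\<close>, so this constant lifts it above the trivial bound 2 B for the
      oscillation.\<close>
    show "2 * B / s \<ge> 0" using s B0 by simp
    fix x
    \<comment> \<open>Chosen so that x + k is an integer translate of \<open>x\<close> at distance
      at most 1/2 from \<open>y\<close>.\<close>
    define k where "k = round (y - x)"
    define x' where "x' = x + of_int k"
    have x': "\<bar>x' - y\<bar> \<le> 1/2"
      using of_int_round_abs_le[of "y - x"] by (simp add: x'_def k_def algebra_simps)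
    have \<phi>x: "\<phi> x' = \<phi> x" unfolding x'_def by (rule periodic_add_of_int[of \<phi>, OF per])
    have "(sin (pi * (y - x)))\<^sup>2 = (sin (pi * (y - x')))\<^sup>2"
    proof -
      \<comment> \<open>Doubling the angle avoids the sign that the sine picks up under integer
        shifts.\<close>
      have "2 * (pi * (y - x')) = 2 * (pi * (y - x)) - 2 * pi * of_int k"
        by (simp add: x'_def algebra_simps)
      then have "cos (2 * (pi * (y - x'))) = cos (2 * (pi * (y - x)))"
        by (simp only: cos_diff) (simp add: cos_int_2pin sin_int_2pin)
      then show ?thesis by (simp add: cos_double_sin)
    qed
    also have "\<dots> = (sin (pi * \<bar>x' - y\<bar>))\<^sup>2"
    proof (cases "x' \<ge> y")
      case True
      then have "pi * (y - x') = - (pi * \<bar>x' - y\<bar>)" by (simp add: algebra_simps)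
      then show ?thesis by simp
    qed (simp add: abs_if)
    finally have sineq: "(sin (pi * (y - x)))\<^sup>2 = (sin (pi * \<bar>x' - y\<bar>))\<^sup>2" .
    show "\<bar>\<phi> x - \<phi> y\<bar> \<le> e + 2 * B / s * (sin (pi * (y - x)))\<^sup>2"
    proof (cases "\<bar>x' - y\<bar> < d")
      case True
      then have "\<bar>\<phi> x - \<phi> y\<bar> \<le> e" using d(3)[of x'] \<phi>x by simp
      moreover have "2 * B / s * (sin (pi * (y - x)))\<^sup>2 \<ge> 0" using B0 s by simp
      ultimately show ?thesis by linarith
    next
      case False
      have "0 \<le> pi * d" "pi * d \<le> pi * \<bar>x' - y\<bar>" "pi * \<bar>x' - y\<bar> \<le> pi * (1 / 2)"
        using False x' d(1) by (auto intro!: mult_left_mono)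
      then have "sin (pi * d) \<le> sin (pi * \<bar>x' - y\<bar>)"
        using pi_gt_zero by (intro sin_monotone_2pi_le) linarith+
      then have "s \<le> (sin (pi * (y - x)))\<^sup>2"
        unfolding sineq s_def using spos by (intro power_mono) auto
      then have "2 * B / s * s \<le> 2 * B / s * (sin (pi * (y - x)))\<^sup>2"
        using B0 s by (intro mult_left_mono) auto
      then have "2 * B \<le> 2 * B / s * (sin (pi * (y - x)))\<^sup>2" using s by simp
      moreover have "\<bar>\<phi> x - \<phi> y\<bar> \<le> 2 * B"
      proof -
        have "x' \<in> {y - 1..y + 1}" using x' unfolding atLeastAtMost_iff by linarith
        then show ?thesis using B[of x'] B[of y] \<phi>x by simp
      qed
      ultimately show ?thesis using e by linarith
    qed
  qed
qed

lemma fejer_eq_trig: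
  "fejer K (y - x) = 1 + trig K (\<lambda>n. 2 * (1 - real n / real (Suc K)) * cos (2 * pi * n * y))
    (\<lambda>n. 2 * (1 - real n / real (Suc K)) * sin (2 * pi * n * y)) x"
proof -
  have "2 * pi * real n * (y - x) = 2 * pi * real n * y - 2 * pi * real n * x" for n
    by (simp add: algebra_simps)
  then show ?thesis
    by (simp add: fejer_def trig_def cos_diff distrib_left mult.assoc)
qed

lemma continuous_on_fejer: "continuous_on A (\<lambda>x. fejer K (y - x))"
  unfolding fejer_eq_trig
  by (intro continuous_on_add continuous_on_const smooth_continuous_on[OF smooth_trig])

lemma has_integral_fejer: "((\<lambda>x. fejer K (y - x)) has_integral 1) {0..1}"
  unfolding fejer_eq_trig
  using has_integral_add[OF has_integral_const_real[of "1::real" 0 1] has_integral_trig] by simp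

text \<open>A nonnegative kernel of integral 1 averages the oscillation of \<phi> around
  \<open>y\<close>. The squared sine in the oscillation bound cancels the denominator of the kernel
  and leaves M / (K + 1).\<close>

lemma fejer_tendsto:
  fixes \<phi> :: "real \<Rightarrow> real"
  assumes cont: "continuous_on UNIV \<phi>" and per: "\<And>x. \<phi> (x + 1) = \<phi> x"
  shows "(\<lambda>K. integral {0..1} (\<lambda>x. \<phi> x * fejer K (y - x))) \<longlonglongrightarrow> \<phi> y"
proof (rule LIMSEQ_I)
  fix r :: real assume "r > 0"
  then have r: "r / 2 > 0" by simp
  obtain M where M: "M \<ge> 0" "\<And>x. \<bar>\<phi> x - \<phi> y\<bar> \<le> r / 2 + M * (sin (pi * (y - x)))\<^sup>2"
    using continuous_periodic_oscillation[OF cont per r] by metis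
  have c\<phi>: "continuous_on {0..1} \<phi>" using cont continuous_on_subset by blast
  have bound: "\<bar>integral {0..1} (\<lambda>x. \<phi> x * fejer K (y - x)) - \<phi> y\<bar> \<le> r / 2 + M / real (Suc K)" for K
  proof -
    have i1: "(\<lambda>x. \<phi> x * fejer K (y - x)) integrable_on {0..1}"
      by (intro integrable_continuous_real continuous_on_mult c\<phi> continuous_on_fejer)
    have i2: "(\<lambda>x. (\<phi> x - \<phi> y) * fejer K (y - x)) integrable_on {0..1}"
      by (intro integrable_continuous_real continuous_on_mult continuous_on_diff c\<phi> continuous_on_fejer
          continuous_on_const)
    have "integral {0..1} (\<lambda>x. (\<phi> x - \<phi> y) * fejer K (y - x))
        = integral {0..1} (\<lambda>x. \<phi> x * fejer K (y - x)) - \<phi> y * 1"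
      using has_integral_diff[OF integrable_integral[OF i1] has_integral_mult_right[OF has_integral_fejer[of K y], of "\<phi> y"]]
      by (intro integral_unique) (simp add: left_diff_distrib)
    then have "\<bar>integral {0..1} (\<lambda>x. \<phi> x * fejer K (y - x)) - \<phi> y\<bar>
        = norm (integral {0..1} (\<lambda>x. (\<phi> x - \<phi> y) * fejer K (y - x)))" by simp
    also have "\<dots> \<le> integral {0..1} (\<lambda>x. r / 2 * fejer K (y - x) + M / real (Suc K))"
    proof (rule integral_norm_bound_integral[OF i2])
      show "(\<lambda>x. r / 2 * fejer K (y - x) + M / real (Suc K)) integrable_on {0..1}"
        by (intro integrable_continuous_real continuous_intros continuous_on_fejer)
      fix x
      have "norm ((\<phi> x - \<phi> y) * fejer K (y - x))
          \<le> (r / 2 + M * (sin (pi * (y - x)))\<^sup>2) * fejer K (y - x)"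
        unfolding norm_mult using M(2)[of x] fejer_nonneg[of K "y - x"]
        by (simp add: mult_right_mono)
      also have "\<dots> = r / 2 * fejer K (y - x) + M * (fejer K (y - x) * (sin (pi * (y - x)))\<^sup>2)"
        by (simp add: algebra_simps)
      also have "fejer K (y - x) * (sin (pi * (y - x)))\<^sup>2 = (sin (Suc K * (pi * (y - x))))\<^sup>2 / real (Suc K)"
        unfolding fejer_times_sin_square[symmetric] by simp
      also have "M * ((sin (Suc K * (pi * (y - x))))\<^sup>2 / real (Suc K)) \<le> M * (1 / real (Suc K))"
        by (intro mult_left_mono divide_right_mono M(1)) (simp_all add: power_le_one_iff abs_square_le_1)
      finally show "norm ((\<phi> x - \<phi> y) * fejer K (y - x)) \<le> r / 2 * fejer K (y - x) + M / real (Suc K)"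
        by simp
    qed
    also have "\<dots> = r / 2 * 1 + M / real (Suc K)"
    proof (rule integral_unique)
      have "((\<lambda>x. M / real (Suc K)) has_integral M / real (Suc K)) {0..1::real}"
        using has_integral_const_real[of "M / real (Suc K)" 0 1] by simp
      then show "((\<lambda>x. r / 2 * fejer K (y - x) + M / real (Suc K)) has_integral r / 2 * 1 + M / real (Suc K)) {0..1}"
        by (intro has_integral_add has_integral_mult_right has_integral_fejer)
    qed
    finally show ?thesis by simp
  qed
  have "(\<lambda>K. M / real (Suc K)) \<longlonglongrightarrow> 0"
    using tendsto_mult_right_zero[OF LIMSEQ_inverse_real_of_nat, of M] by (simp add: divide_inverse)
  then obtain K0 where K0: "\<And>K. K \<ge> K0 \<Longrightarrow> norm (M / real (Suc K)) < r / 2"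
    using LIMSEQ_D[OF _ r] by fastforce
  show "\<exists>K0. \<forall>K\<ge>K0. norm (integral {0..1} (\<lambda>x. \<phi> x * fejer K (y - x)) - \<phi> y) < r"
  proof (intro exI allI impI)
    fix K assume "K \<ge> K0"
    have "M / real (Suc K) < r / 2"
      using K0[OF \<open>K \<ge> K0\<close>] unfolding real_norm_def by linarith
    then show "norm (integral {0..1} (\<lambda>x. \<phi> x * fejer K (y - x)) - \<phi> y) < r"
      using bound[of K] unfolding real_norm_def by linarith
  qed
qed

section \<open>The even Bernoulli functions\<close>

lemma summable_bernoulli:
  assumes "m \<ge> 1"
  shows "summable (\<lambda>n. 1 / (2 * pi * real (Suc n)) ^ (2 * m))"
proof (rule summable_comparison_test')
  show "summable (\<lambda>n. 1 / (real (n + 1))\<^sup>2)"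
    using inverse_squares_sums by (simp add: sums_iff add.commute)
  fix n
  have "1 * real (n + 1) \<le> 2 * pi * real (Suc n)"
    using pi_gt3 by (intro mult_mono) auto
  then have "(real (n + 1))\<^sup>2 \<le> (2 * pi * real (Suc n))\<^sup>2"
    by (intro power_mono) auto
  also have "\<dots> \<le> (2 * pi * real (Suc n)) ^ (2 * m)"
  proof (rule power_increasing)
    have "1 * 1 \<le> (2 * pi) * real (Suc n)"
      using pi_gt3 by (intro mult_mono) auto
    then show "1 \<le> 2 * pi * real (Suc n)" by simp
  qed (use assms in simp)
  finally show "norm (1 / (2 * pi * real (Suc n)) ^ (2 * m)) \<le> 1 / (real (n + 1))\<^sup>2"
    by (simp add: frac_le)
qed

lemma summable_cos_bernoulli:
  assumes m: "m \<ge> 1"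
  shows "summable (\<lambda>n. 2 * cos (2 * pi * real (Suc n) * t) / (2 * pi * real (Suc n)) ^ (2 * m))"
proof (rule summable_comparison_test'[OF summable_mult[OF summable_bernoulli[OF m], of 2]])
  fix n
  have "\<bar>2 * cos (2 * pi * real (Suc n) * t)\<bar> / \<bar>(2 * pi * real (Suc n)) ^ (2 * m)\<bar>
      \<le> 2 / \<bar>(2 * pi * real (Suc n)) ^ (2 * m)\<bar>"
    by (intro divide_right_mono) (auto simp: abs_mult)
  then show "norm (2 * cos (2 * pi * real (Suc n) * t) / (2 * pi * real (Suc n)) ^ (2 * m))
      \<le> 2 * (1 / (2 * pi * real (Suc n)) ^ (2 * m))"
    by (simp add: abs_divide del: of_nat_Suc)
qed

text \<open>The frequencies \<beta> and -\<beta> have equal denominators and combine to twice a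
  cosine. Absolute summability, where \<open>m \<ge> 1\<close> enters, lets the unordered sum be
  split into two series.\<close>

lemma bernoulli_even_eq_suminf:
  assumes m: "m \<ge> 1"
  shows "bernoulli_even m x =
    (-1) ^ m * of_real (\<Sum>n. 2 * cos (2 * pi * real (Suc n) * x) / (2 * pi * real (Suc n)) ^ (2 * m))"
proof -
  define t :: "int \<Rightarrow> complex" where "t \<beta> = exp (- 2 * of_real pi * \<i> * of_int \<beta> * of_real x)
                               / (2 * of_real pi * \<i> * of_int \<beta>) ^ (2 * m)" for \<beta>
  have t_eq: "t \<beta> = (-1) ^ m * cis (- (2 * pi * of_int \<beta> * x)) / of_real ((2 * pi * of_int \<beta>) ^ (2 * m))" for \<beta>
  proof -
    have "(2 * of_real pi * \<i> * of_int \<beta>) ^ (2 * m) = ((\<i> * of_real (2 * pi * of_int \<beta>)) ^ 2) ^ m"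
      by (simp add: power_mult[symmetric] mult_ac)
    also have "\<dots> = (-1) ^ m * of_real ((2 * pi * of_int \<beta>) ^ (2 * m))"
    proof -
      have "((\<i> * complex_of_real y) ^ 2) ^ m = (-1) ^ m * complex_of_real (y ^ (2 * m))" for y
        by (simp only: power_mult_distrib power2_i of_real_power power_mult)
      then show ?thesis .
    qed
    finally have e: "(2 * of_real pi * \<i> * of_int \<beta>) ^ (2 * m)
      = (-1) ^ m * complex_of_real ((2 * pi * of_int \<beta>) ^ (2 * m))" .
    have "exp (- 2 * of_real pi * \<i> * of_int \<beta> * of_real x) = cis (- (2 * pi * of_int \<beta> * x))"
      by (simp add: cis_conv_exp mult_ac)
    moreover have "a / ((-1) ^ m * b) = (-1) ^ m * a / b" for a b :: complex
      by (cases "even m") auto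
    ultimately show ?thesis unfolding t_def e by simp
  qed
  define q where "q n = (2 * pi * real (Suc n)) ^ (2 * m)" for n
  \<comment> \<open>\<open>p\<close> runs through the positive integers and its negative through the
    negative ones; \<open>Suc\<close> skips zero.\<close>
  define p where "p n = int (Suc n)" for n
  have rp: "real_of_int (p n) = real (Suc n)" "real_of_int (- p n) = - real (Suc n)" for n
    by (simp_all add: p_def)
  have tp: "t (p n) = (-1) ^ m * cis (- (2 * pi * real (Suc n) * x)) / of_real (q n)"
    and tm: "t (- p n) = (-1) ^ m * cis (2 * pi * real (Suc n) * x) / of_real (q n)" for n
    unfolding t_eq rp q_def by (simp_all del: of_nat_Suc of_real_power of_real_mult)
  have sq: "summable (\<lambda>n. 1 / q n)" unfolding q_def by (rule summable_bernoulli[OF m])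
  have qpos: "q n > 0" for n by (simp add: q_def)
  have np: "norm (t (p n)) = 1 / q n" and nm: "norm (t (- p n)) = 1 / q n" for n
    unfolding tp tm using qpos[of n] by (simp_all add: norm_divide norm_mult norm_power)
  have hp: "((\<lambda>n. t (p n)) has_sum (\<Sum>n. t (p n))) UNIV"
    and hm: "((\<lambda>n. t (- p n)) has_sum (\<Sum>n. t (- p n))) UNIV"
    by (rule norm_summable_imp_has_sum; use sq in \<open>simp add: np nm summable_norm_cancel summable_sums\<close>)+
  have injp: "inj p" "inj (\<lambda>n. - p n)" by (auto simp: inj_on_def p_def)
  have "(t has_sum (\<Sum>n. t (p n))) (range p)"
    using has_sum_reindex[OF injp(1), of t] hp by (simp add: o_def)
  moreover have "(t has_sum (\<Sum>n. t (- p n))) (range (\<lambda>n. - p n))"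
    using has_sum_reindex[OF injp(2), of t] hm by (simp add: o_def)
  moreover have "range p \<inter> range (\<lambda>n. - p n) = {}" by (auto simp: p_def)
  moreover have "range p \<union> range (\<lambda>n. - p n) = UNIV - {0}"
  proof -
    have "k \<in> range p \<union> range (\<lambda>n. - p n)" if "k \<noteq> 0" for k
    proof (cases "k > 0")
      case True
      then have "k = p (nat k - 1)" by (simp add: p_def)
      then show ?thesis by blast
    next
      case False
      with that have "k = - p (nat (- k) - 1)" by (simp add: p_def)
      then show ?thesis by blast
    qed
    then show ?thesis by (auto simp: p_def)
  qed
  ultimately have "(t has_sum ((\<Sum>n. t (p n)) + (\<Sum>n. t (- p n)))) (UNIV - {0})"
    using has_sum_Un_disjoint by metis
  then have "bernoulli_even m x = (\<Sum>n. t (p n)) + (\<Sum>n. t (- p n))"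
    unfolding bernoulli_even_def t_def[symmetric] by (rule infsumI)
  also have "\<dots> = (\<Sum>n. t (p n) + t (- p n))"
    by (rule suminf_add) (rule summable_norm_cancel; simp add: np nm sq)+
  also have "\<dots> = (\<Sum>n. (-1) ^ m * complex_of_real (2 * cos (2 * pi * real (Suc n) * x) / q n))"
  proof (rule suminf_cong)
    fix n
    have "cis (- u) + cis u = 2 * complex_of_real (cos u)" for u
      by (simp add: complex_eq_iff)
    then show "t (p n) + t (- p n) = (-1) ^ m * complex_of_real (2 * cos (2 * pi * real (Suc n) * x) / q n)"
      unfolding tp tm by (simp only: add_divide_distrib[symmetric] distrib_left[symmetric]) simp
  qed
  also have "\<dots> = (-1) ^ m * of_real (\<Sum>n. 2 * cos (2 * pi * real (Suc n) * x) / q n)"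
  proof -
    have "summable (\<lambda>n. 2 * cos (2 * pi * real (Suc n) * x) / q n)"
      unfolding q_def by (rule summable_cos_bernoulli[OF m])
    then have "(\<lambda>n. 2 * cos (2 * pi * real (Suc n) * x) / q n) sums
        (\<Sum>n. 2 * cos (2 * pi * real (Suc n) * x) / q n)" by (rule summable_sums)
    then have "(\<lambda>n. (-1) ^ m * complex_of_real (2 * cos (2 * pi * real (Suc n) * x) / q n)) sums
      ((-1) ^ m * of_real (\<Sum>n. 2 * cos (2 * pi * real (Suc n) * x) / q n))"
      by (intro sums_mult sums_of_real)
    then show ?thesis by (rule sums_unique[symmetric])
  qed
  finally show ?thesis by (simp add: q_def)
qed

section \<open>The norm of the error functional\<close>

lemma Cauchy_Schwarz_integral:
  fixes f g :: "real \<Rightarrow> real"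
  assumes f: "(\<lambda>x. (f x)\<^sup>2) integrable_on S" and g: "(\<lambda>x. (g x)\<^sup>2) integrable_on S"
    and fg: "(\<lambda>x. f x * g x) integrable_on S"
  shows "\<bar>integral S (\<lambda>x. f x * g x)\<bar> \<le> sqrt (integral S (\<lambda>x. (f x)\<^sup>2)) * sqrt (integral S (\<lambda>x. (g x)\<^sup>2))"
proof -
  define F G P where "F = integral S (\<lambda>x. (f x)\<^sup>2)" and "G = integral S (\<lambda>x. (g x)\<^sup>2)"
    and "P = integral S (\<lambda>x. f x * g x)"
  have G: "G \<ge> 0" unfolding G_def by (intro integral_nonneg g) simp
  have quad: "F - 2 * t * P + t\<^sup>2 * G \<ge> 0" for t
  proof -
    have I: "((\<lambda>x. (f x)\<^sup>2 - 2 * t * (f x * g x) + t\<^sup>2 * (g x)\<^sup>2) has_integral F - 2 * t * P + t\<^sup>2 * G) S"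
      unfolding F_def G_def P_def
      by (intro has_integral_add has_integral_diff has_integral_mult_right integrable_integral f g fg)
    have "(f x)\<^sup>2 - 2 * t * (f x * g x) + t\<^sup>2 * (g x)\<^sup>2 = (f x - t * g x)\<^sup>2" for x
      by (simp add: power2_eq_square algebra_simps)
    then show ?thesis
      by (intro has_integral_nonneg[OF I]) (simp only: zero_le_power2)
  qed
  have "P\<^sup>2 \<le> F * G"
  proof (cases "G = 0")
    case True
    have "P = 0"
    proof (rule ccontr)
      assume "P \<noteq> 0"
      \<comment> \<open>For \<open>G = 0\<close> the quadratic is affine in \<open>t\<close>, and
        this value of \<open>t\<close> makes it F - (F + 1) = -1.\<close>
      then show False using quad[of "(F + 1) / (2 * P)"] True by simp
    qed
    with True show ?thesis by simp
  next
    case False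
    then have "F - 2 * (P / G) * P + (P / G)\<^sup>2 * G = F - P\<^sup>2 / G"
      by (simp add: power2_eq_square field_simps)
    with quad[of "P / G"] have "P\<^sup>2 / G \<le> F" by simp
    with G False show ?thesis by (simp add: field_simps)
  qed
  then have "sqrt (P\<^sup>2) \<le> sqrt (F * G)" by (rule real_sqrt_le_mono)
  then show ?thesis by (simp add: F_def G_def P_def real_sqrt_mult)
qed

section \<open>Membership and norms in the periodic space\<close>

lemma periodic_L2_weak_deriv:
  assumes "\<phi> \<in> periodic_L2 m"
  shows "has_weak_deriv m \<phi> (weak_deriv m \<phi>)"
proof -
  have "\<exists>g. has_weak_deriv m \<phi> g" using assms by (simp add: periodic_L2_def)
  then show ?thesis unfolding weak_deriv_def by (rule someI_ex[of "has_weak_deriv m \<phi>"])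
qed

lemma periodic_L2_norm_eq:
  assumes "\<phi> \<in> periodic_L2 m"
  shows "periodic_L2_norm m \<phi> = sqrt (integral {0..1} (\<lambda>x. (weak_deriv m \<phi> x)\<^sup>2))"
  using assms unfolding periodic_L2_norm_def periodic_L2_def
  by (simp add: set_lebesgue_integral_eq_integral)

text \<open>The chosen generalized derivative differs from the classical one only on a negligible
  set, which changes neither integrability nor the integral.\<close>

lemma smooth_periodic_in_periodic_L2:
  assumes u: "smooth u" and per: "\<And>x. u (x + 1) = u x"
  shows "u \<in> periodic_L2 m"
    and "periodic_L2_norm m u = sqrt (integral {0..1} (\<lambda>x. ((deriv ^^ m) u x)\<^sup>2))"
proof -
  have w: "has_weak_deriv m u ((deriv ^^ m) u)" by (rule smooth_has_weak_deriv[OF u])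
  then have "has_weak_deriv m u (weak_deriv m u)"
    unfolding weak_deriv_def by (rule someI[of "has_weak_deriv m u"])
  from AE_lebesgue_negligible[OF has_weak_deriv_AE_unique[OF this w]]
  obtain N where N: "negligible N" "\<And>x. x \<notin> N \<Longrightarrow> weak_deriv m u x = (deriv ^^ m) u x"
    by metis
  have "(\<lambda>x. ((deriv ^^ m) u x)\<^sup>2) absolutely_integrable_on {0..1}"
    by (intro absolutely_integrable_continuous_real continuous_on_power smooth_continuous_on
        smooth_funpow_deriv u)
  then have "(\<lambda>x. (weak_deriv m u x)\<^sup>2) absolutely_integrable_on {0..1}"
    by (rule absolutely_integrable_spike[OF _ N(1)]) (simp add: N(2))
  then show m: "u \<in> periodic_L2 m"
    unfolding periodic_L2_def
    using per smooth_has_weak_deriv[OF u] smooth_continuous_on[OF u] by blast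
  have "integral {0..1} (\<lambda>x. (weak_deriv m u x)\<^sup>2) = integral {0..1} (\<lambda>x. ((deriv ^^ m) u x)\<^sup>2)"
    by (rule integral_spike[OF N(1)]) (simp add: N(2))
  then show "periodic_L2_norm m u = sqrt (integral {0..1} (\<lambda>x. ((deriv ^^ m) u x)\<^sup>2))"
    by (simp add: periodic_L2_norm_eq[OF m])
qed

lemmas trig_in_periodic_L2 = smooth_periodic_in_periodic_L2(1)[OF smooth_trig trig_periodic]

lemma periodic_L2_norm_trig:
  "periodic_L2_norm m (trig K a b) = sqrt (\<Sum>n=1..K. (2 * pi * n) ^ (2 * m) * ((a n)\<^sup>2 + (b n)\<^sup>2) / 2)"
  using smooth_periodic_in_periodic_L2(2)[OF smooth_trig trig_periodic]
    integral_unique[OF has_integral_trig_deriv_square] by simp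

section \<open>The error functional and its Fourier coefficients\<close>

lemma error_functional_linear:
  "error_functional N C x z (\<lambda>t. a * \<phi> t + b * \<psi> t)
    = a * error_functional N C x z \<phi> + b * error_functional N C x z \<psi>"
  by (simp add: error_functional_def sum.distrib sum_distrib_left algebra_simps)

lemma error_functional_const: "(\<Sum>k=1..N. C k) = 1 \<Longrightarrow> error_functional N C x z (\<lambda>_. c) = 0"
  by (simp add: error_functional_def flip: sum_distrib_right)

lemma error_functional_sum:
  "error_functional N C x z (\<lambda>t. \<Sum>i\<in>I. f i t) = (\<Sum>i\<in>I. error_functional N C x z (f i))"
proof (induction I rule: infinite_finite_induct)
  case (insert i I)
  then show ?case using error_functional_linear[of N C x z 1 "f i" 1 "\<lambda>t. \<Sum>i\<in>I. f i t"] by simp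
qed (simp_all add: error_functional_def)

context
  fixes m N :: nat and z :: real and x C :: "nat \<Rightarrow> real"
begin

definition cos_coeff :: "nat \<Rightarrow> real" where
  "cos_coeff n = error_functional N C x z (\<lambda>t. cos (2 * pi * n * t))"

definition sin_coeff :: "nat \<Rightarrow> real" where
  "sin_coeff n = error_functional N C x z (\<lambda>t. sin (2 * pi * n * t))"

text \<open>The squared norm of the n-th mode of the Riesz representer, for n \<ge> 1: coefficients
  2 A_n / (2 pi n)^{2m} and 2 B_n / (2 pi n)^{2m} contribute a square 4, Parseval a factor
  1/2.\<close>

definition mode_energy :: "nat \<Rightarrow> real" where
  "mode_energy n = 2 * ((cos_coeff n)\<^sup>2 + (sin_coeff n)\<^sup>2) / (2 * pi * n) ^ (2 * m)"

lemma mode_energy_nonneg: "mode_energy n \<ge> 0"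
  by (simp add: mode_energy_def)

lemma error_functional_trig:
  "error_functional N C x z (trig K a b) = (\<Sum>n=1..K. a n * cos_coeff n + b n * sin_coeff n)"
  unfolding trig_def[abs_def] error_functional_sum cos_coeff_def sin_coeff_def
  by (simp only: error_functional_linear)

text \<open>The functional is a finite combination of point values in \<open>y\<close>, so it passes
  under the integral over \<open>t\<close> and acts on the kernel alone.\<close>

lemma error_functional_fejer:
  assumes C: "(\<Sum>k=1..N. C k) = 1" and \<phi>: "continuous_on UNIV \<phi>"
  shows "error_functional N C x z (\<lambda>y. integral {0..1} (\<lambda>t. \<phi> t * fejer K (y - t)))
    = integral {0..1} (\<lambda>t. \<phi> t * trig K (\<lambda>n. 2 * (1 - real n / real (Suc K)) * cos_coeff n)
        (\<lambda>n. 2 * (1 - real n / real (Suc K)) * sin_coeff n) t)"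
proof -
  let ?w = "\<lambda>n. 2 * (1 - real n / real (Suc K))"
  have c\<phi>: "continuous_on {0..1} \<phi>" using \<phi> continuous_on_subset by blast
  have i: "(\<lambda>t. \<phi> t * fejer K (y - t)) integrable_on {0..1}" for y
    by (intro integrable_continuous_real continuous_on_mult c\<phi> continuous_on_fejer)
  have "error_functional N C x z (\<lambda>y. integral {0..1} (\<lambda>t. \<phi> t * fejer K (y - t)))
      = integral {0..1} (\<lambda>t. \<phi> t * fejer K (z - t) - (\<Sum>k=1..N. C k * (\<phi> t * fejer K (x k - t))))"
    unfolding error_functional_def
    by (rule integral_unique[symmetric])
      (intro has_integral_diff has_integral_sum has_integral_mult_right integrable_integral i; simp)
  moreover have "\<phi> t * fejer K (z - t) - (\<Sum>k=1..N. C k * (\<phi> t * fejer K (x k - t)))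
      = \<phi> t * error_functional N C x z (\<lambda>y. fejer K (y - t))" for t
    by (simp add: error_functional_def right_diff_distrib sum_distrib_left mult.left_commute)
  moreover have "error_functional N C x z (\<lambda>y. fejer K (y - t))
      = trig K (\<lambda>n. ?w n * cos_coeff n) (\<lambda>n. ?w n * sin_coeff n) t" for t
  proof -
    \<comment> \<open>The kernel is read as a polynomial in \<open>y\<close> with coefficients
      depending on \<open>t\<close>; the factors 1 give the sum the shape that
      \<open>error_functional_linear\<close> expects.\<close>
    have "fejer K (y - t) = 1 * 1 + 1 * trig K (\<lambda>n. ?w n * cos (2 * pi * n * t))
        (\<lambda>n. ?w n * sin (2 * pi * n * t)) y" for y
      unfolding fejer_eq_trig by (simp add: trig_def mult_ac)
    then have "error_functional N C x z (\<lambda>y. fejer K (y - t))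
        = 1 * error_functional N C x z (\<lambda>_. 1) + 1 * error_functional N C x z
          (trig K (\<lambda>n. ?w n * cos (2 * pi * n * t)) (\<lambda>n. ?w n * sin (2 * pi * n * t)))"
      by (simp only: error_functional_linear)
    then show ?thesis
      unfolding error_functional_const[OF C] error_functional_trig by (simp add: trig_def mult_ac)
  qed
  ultimately show ?thesis by (simp only:)
qed

text \<open>A bound uniform in \<open>K\<close> survives the limit of the Cesaro means;
  Cauchy-Schwarz separates the norm of \<phi> from that of the antiderivative polynomial.\<close>

lemma error_functional_bound:
  assumes C: "(\<Sum>k=1..N. C k) = 1" and \<phi>: "\<phi> \<in> periodic_L2 m"
    and S: "(\<lambda>n. mode_energy (Suc n)) sums S"
  shows "\<bar>error_functional N C x z \<phi>\<bar> \<le> sqrt S * periodic_L2_norm m \<phi>"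
proof -
  define g where "g = weak_deriv m \<phi>"
  have w: "has_weak_deriv m \<phi> g" unfolding g_def by (rule periodic_L2_weak_deriv[OF \<phi>])
  have cont: "continuous_on UNIV \<phi>" and per: "\<And>x. \<phi> (x + 1) = \<phi> x"
    and g2: "(\<lambda>x. (g x)\<^sup>2) absolutely_integrable_on {0..1}"
    using \<phi> by (auto simp: periodic_L2_def g_def)
  define L where "L K = error_functional N C x z (\<lambda>y. integral {0..1} (\<lambda>t. \<phi> t * fejer K (y - t)))" for K
  have "L \<longlonglongrightarrow> error_functional N C x z \<phi>"
    unfolding L_def error_functional_def
    by (intro tendsto_diff tendsto_sum tendsto_mult tendsto_const fejer_tendsto cont per)
  moreover have "\<bar>L K\<bar> \<le> sqrt S * periodic_L2_norm m \<phi>" for K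
  proof -
    let ?w = "\<lambda>n. 2 * (1 - real n / real (Suc K))"
    obtain a b where ab: "(deriv ^^ m) (trig K a b) = trig K (\<lambda>n. ?w n * cos_coeff n) (\<lambda>n. ?w n * sin_coeff n)"
      "\<And>n. n \<in> {1..K} \<Longrightarrow> (a n)\<^sup>2 + (b n)\<^sup>2
        = ((?w n * cos_coeff n)\<^sup>2 + (?w n * sin_coeff n)\<^sup>2) / (2 * pi * n) ^ (2 * m)"
      using trig_funpow_antideriv[of m K "\<lambda>n. ?w n * cos_coeff n" "\<lambda>n. ?w n * sin_coeff n"] by auto
    have "L K = integral {0..1} (\<lambda>t. \<phi> t * (deriv ^^ m) (trig K a b) t)"
      unfolding L_def error_functional_fejer[OF C cont] ab(1) ..
    also have "\<dots> = (-1) ^ m * integral {0..1} (\<lambda>t. g t * trig K a b t)"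
      by (rule has_weak_deriv_integral_period[OF w per smooth_trig trig_periodic])
    finally have "\<bar>L K\<bar> = \<bar>integral {0..1} (\<lambda>t. g t * trig K a b t)\<bar>"
      by (simp add: abs_mult power_abs)
    also have "\<dots> \<le> sqrt (integral {0..1} (\<lambda>t. (g t)\<^sup>2)) * sqrt (integral {0..1} (\<lambda>t. (trig K a b t)\<^sup>2))"
    proof (rule Cauchy_Schwarz_integral)
      show "(\<lambda>t. (g t)\<^sup>2) integrable_on {0..1}"
        using g2 by (simp add: absolutely_integrable_on_def)
      show "(\<lambda>t. (trig K a b t)\<^sup>2) integrable_on {0..1}"
        using has_integral_trig_square by blast
      have "(\<lambda>t. g t * trig K a b t) absolutely_integrable_on {0..1}"
        using w by (intro locally_summable_mult_continuous smooth_continuous_on smooth_trig)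
          (simp add: has_weak_deriv_def)
      then show "(\<lambda>t. g t * trig K a b t) integrable_on {0..1}"
        by (simp add: absolutely_integrable_on_def)
    qed
    also have "sqrt (integral {0..1} (\<lambda>t. (g t)\<^sup>2)) = periodic_L2_norm m \<phi>"
      unfolding g_def by (rule periodic_L2_norm_eq[OF \<phi>, symmetric])
    also have "integral {0..1} (\<lambda>t. (trig K a b t)\<^sup>2) = (\<Sum>n=1..K. ((a n)\<^sup>2 + (b n)\<^sup>2) / 2)"
      by (rule integral_unique[OF has_integral_trig_square])
    also have "periodic_L2_norm m \<phi> * sqrt (\<Sum>n=1..K. ((a n)\<^sup>2 + (b n)\<^sup>2) / 2)
        \<le> periodic_L2_norm m \<phi> * sqrt S"
    proof (intro mult_left_mono real_sqrt_le_mono)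
      have "(\<Sum>n=1..K. ((a n)\<^sup>2 + (b n)\<^sup>2) / 2) \<le> (\<Sum>n=1..K. mode_energy n)"
      proof (rule sum_mono)
        fix n assume n: "n \<in> {1..K}"
        \<comment> \<open>The squared weight is at most 4, and together with Parseval's 1/2 this is
          the factor 2 of \<open>mode_energy\<close>.\<close>
        have "0 \<le> ?w n" "?w n \<le> 2" using n by (auto simp: field_simps)
        then have w4: "(?w n)\<^sup>2 \<le> 2\<^sup>2" by (intro power_mono)
        have "((a n)\<^sup>2 + (b n)\<^sup>2) / 2
          = (?w n)\<^sup>2 * (((cos_coeff n)\<^sup>2 + (sin_coeff n)\<^sup>2) / (2 * pi * n) ^ (2 * m) / 2)"
          unfolding ab(2)[OF n] by (simp only: power_mult_distrib distrib_left[symmetric] times_divide_eq_right)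
        also have "\<dots> \<le> 2\<^sup>2 * (((cos_coeff n)\<^sup>2 + (sin_coeff n)\<^sup>2) / (2 * pi * n) ^ (2 * m) / 2)"
          by (rule mult_right_mono[OF w4]) simp
        also have "\<dots> = mode_energy n"
        proof -
          have "2\<^sup>2 * (X / q / 2) = 2 * X / q" for X q :: real by simp
          then show ?thesis unfolding mode_energy_def .
        qed
        finally show "((a n)\<^sup>2 + (b n)\<^sup>2) / 2 \<le> mode_energy n" .
      qed
      also have "\<dots> = (\<Sum>n<K. mode_energy (Suc n))" by (simp add: sum.atLeast1_atMost_eq)
      also have "\<dots> \<le> S"
        using sum_le_suminf[OF sums_summable[OF S], of "{..<K}"] mode_energy_nonneg sums_unique[OF S] by simp
      finally show "(\<Sum>n=1..K. ((a n)\<^sup>2 + (b n)\<^sup>2) / 2) \<le> S" .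
      have "integral {0..1} (\<lambda>x. (g x)\<^sup>2) \<ge> 0"
        using g2 by (intro integral_nonneg) (auto simp: absolutely_integrable_on_def)
      then show "periodic_L2_norm m \<phi> \<ge> 0"
        unfolding periodic_L2_norm_eq[OF \<phi>] g_def[symmetric] by simp
    qed
    finally show ?thesis by (simp add: mult.commute)
  qed
  ultimately show ?thesis
    by (intro Lim_bounded[OF tendsto_rabs]) auto
qed

text \<open>The truncated Riesz representer is a trigonometric polynomial \<open>u\<close> for which the value of the
  functional at \<open>u\<close> and the squared norm of \<open>u\<close> are both the truncated energy.\<close>
lemma error_functional_attains_energy:
  assumes e: "(\<Sum>n=1..K. mode_energy n) > 0"
  obtains \<phi> where "\<phi> \<in> periodic_L2 m" "periodic_L2_norm m \<phi> = 1"
    "error_functional N C x z \<phi> = sqrt (\<Sum>n=1..K. mode_energy n)"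
proof
  define E where "E = (\<Sum>n=1..K. mode_energy n)"
  \<comment> \<open>The representer's multiplier 2 / (2 pi n)^{2m}, divided by the norm
    \<open>sqrt E\<close> of the truncated representer to obtain a unit vector.\<close>
  define c where "c n = 2 / (2 * pi * real n) ^ (2 * m) / sqrt E" for n
  define u where "u = trig K (\<lambda>n. c n * cos_coeff n) (\<lambda>n. c n * sin_coeff n)"
  have E: "E > 0" using e by (simp add: E_def)
  have ss: "sqrt E * sqrt E = E" using E by simp
  show "u \<in> periodic_L2 m" unfolding u_def by (rule trig_in_periodic_L2)
  have "(2 * pi * n) ^ (2 * m) * ((c n * cos_coeff n)\<^sup>2 + (c n * sin_coeff n)\<^sup>2) / 2 = mode_energy n / E"
    if "n \<in> {1..K}" for n
  proof -
    define q where "q = (2 * pi * real n) ^ (2 * m)"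
    have q: "q \<noteq> 0" using that by (simp add: q_def)
    have "(c n)\<^sup>2 = 4 / (q\<^sup>2 * E)"
      using ss by (simp add: c_def q_def[symmetric] power2_eq_square)
    moreover have "q * (4 / (q\<^sup>2 * E) * X) / 2 = 2 * X / q / E" for X
      using q E by (simp add: power2_eq_square)
    ultimately have "q * ((c n)\<^sup>2 * ((cos_coeff n)\<^sup>2 + (sin_coeff n)\<^sup>2)) / 2 = mode_energy n / E"
      by (simp only: mode_energy_def q_def)
    then show ?thesis
      unfolding q_def[symmetric] by (simp only: power_mult_distrib distrib_left)
  qed
  then have "periodic_L2_norm m u = sqrt (\<Sum>n=1..K. mode_energy n / E)"
    unfolding u_def periodic_L2_norm_trig by (intro arg_cong[of _ _ sqrt] sum.cong) auto
  then show "periodic_L2_norm m u = 1"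
    using E by (simp only: sum_divide_distrib[symmetric] E_def[symmetric]) simp
  have "c n * cos_coeff n * cos_coeff n + c n * sin_coeff n * sin_coeff n = mode_energy n / sqrt E" for n
    by (simp add: c_def mode_energy_def power2_eq_square distrib_left add_divide_distrib)
  then have "error_functional N C x z u = E / sqrt E"
    unfolding u_def error_functional_trig by (simp add: sum_divide_distrib[symmetric] E_def)
  then show "error_functional N C x z u = sqrt (\<Sum>n=1..K. mode_energy n)"
    using E by (simp add: real_div_sqrt E_def)
qed

text \<open>The supremum lies between the square roots of the partial energies and
  \<open>sqrt S\<close>; letting \<open>K\<close> grow closes the gap without asking for a
  maximizer.\<close>

lemma dual_norm_error_functional:
  assumes C: "(\<Sum>k=1..N. C k) = 1" and S: "(\<lambda>n. mode_energy (Suc n)) sums S"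
  shows "(periodic_L2_dual_norm m (error_functional N C x z))\<^sup>2 = S"
proof -
  let ?l = "error_functional N C x z" and ?U = "{\<phi> \<in> periodic_L2 m. periodic_L2_norm m \<phi> = 1}"
  have S0: "S \<ge> 0" using sums_le[OF _ sums_zero S] mode_energy_nonneg by simp
  have le: "\<bar>?l \<phi>\<bar> \<le> sqrt S" if "\<phi> \<in> ?U" for \<phi>
    using error_functional_bound[OF C _ S, of \<phi>] that by simp
  then have bdd: "bdd_above ((\<lambda>\<phi>. \<bar>?l \<phi>\<bar>) ` ?U)" by (intro bdd_aboveI2)
  \<comment> \<open>A unit vector independent of the functional: its amplitude cancels the factor (2
    pi)^{2m} / 2 in the norm. It makes the supremum range over a nonempty set and gives the lower
    bound 0 when a partial energy vanishes.\<close>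
  define u where "u = trig 1 (\<lambda>_. sqrt (2 / (2 * pi) ^ (2 * m))) (\<lambda>_. 0)"
  have "periodic_L2_norm m u = 1"
    unfolding u_def periodic_L2_norm_trig by simp
  then have u: "u \<in> ?U" by (simp add: u_def trig_in_periodic_L2)
  have partial: "sqrt (\<Sum>n<K. mode_energy (Suc n)) \<le> (SUP \<phi>\<in>?U. \<bar>?l \<phi>\<bar>)" for K
  proof -
    define E where "E = (\<Sum>n=1..K. mode_energy n)"
    have E0: "E \<ge> 0" unfolding E_def by (intro sum_nonneg mode_energy_nonneg)
    have "sqrt E \<le> (SUP \<phi>\<in>?U. \<bar>?l \<phi>\<bar>)"
    proof (cases "E = 0")
      case True
      have "0 \<le> \<bar>?l u\<bar>" by simp
      also have "\<dots> \<le> (SUP \<phi>\<in>?U. \<bar>?l \<phi>\<bar>)" by (rule cSUP_upper[OF u bdd])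
      finally show ?thesis using True by simp
    next
      case False
      with E0 have "(\<Sum>n=1..K. mode_energy n) > 0" by (simp add: E_def)
      then obtain \<phi> where "\<phi> \<in> ?U" "?l \<phi> = sqrt E"
        unfolding E_def by (rule error_functional_attains_energy) simp
      then show ?thesis using cSUP_upper[OF _ bdd, of \<phi>] E0 by simp
    qed
    then show ?thesis by (simp add: E_def sum.atLeast1_atMost_eq)
  qed
  have "(\<lambda>K. sqrt (\<Sum>n<K. mode_energy (Suc n))) \<longlonglongrightarrow> sqrt S"
    using S unfolding sums_def by (rule tendsto_real_sqrt)
  then have "sqrt S \<le> (SUP \<phi>\<in>?U. \<bar>?l \<phi>\<bar>)"
    by (rule Lim_bounded) (use partial in auto)
  moreover have "(SUP \<phi>\<in>?U. \<bar>?l \<phi>\<bar>) \<le> sqrt S"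
    using u le by (intro cSUP_least) auto
  ultimately have "(SUP \<phi>\<in>?U. \<bar>?l \<phi>\<bar>) = sqrt S" by (intro antisym)
  then show ?thesis
    unfolding periodic_L2_dual_norm_def using real_sqrt_pow2[OF S0] by (simp only:)
qed

lemma error_functional_in_dual:
  assumes C: "(\<Sum>k=1..N. C k) = 1" and S: "(\<lambda>n. mode_energy (Suc n)) sums S"
  shows "error_functional N C x z \<in> periodic_L2_dual m"
  unfolding periodic_L2_dual_def
proof (intro CollectI conjI ballI allI exI)
  show "\<bar>error_functional N C x z \<phi>\<bar> \<le> sqrt S * periodic_L2_norm m \<phi>" if "\<phi> \<in> periodic_L2 m" for \<phi>
    by (rule error_functional_bound[OF C that S])
qed (rule error_functional_linear error_functional_const[OF C])+

text \<open>The left side is the squared modulus of the functional at exp(2 pi i n t). Multiplying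
  it out and joining products by the cosine addition formula leaves only differences of the points.
  The argument 0 is kept visible to match B_{2m}(0).\<close>

lemma coeff_square_sum:
  "(cos_coeff n)\<^sup>2 + (sin_coeff n)\<^sup>2 = cos (2 * pi * n * 0)
    - 2 * (\<Sum>k=1..N. C k * cos (2 * pi * n * (z - x k)))
    + (\<Sum>k=1..N. \<Sum>k'=1..N. C k * C k' * cos (2 * pi * n * (x k - x k')))"
proof -
  let ?c = "\<lambda>t. cos (2 * pi * n * t)" and ?s = "\<lambda>t. sin (2 * pi * n * t)"
  have d: "?c (s - t) = ?c s * ?c t + ?s s * ?s t" for s t
    by (simp add: right_diff_distrib cos_diff)
  have "(cos_coeff n)\<^sup>2 + (sin_coeff n)\<^sup>2 = ((?c z)\<^sup>2 + (?s z)\<^sup>2)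
      - 2 * (?c z * (\<Sum>k=1..N. C k * ?c (x k)) + ?s z * (\<Sum>k=1..N. C k * ?s (x k)))
      + ((\<Sum>k=1..N. C k * ?c (x k)) * (\<Sum>k=1..N. C k * ?c (x k))
        + (\<Sum>k=1..N. C k * ?s (x k)) * (\<Sum>k=1..N. C k * ?s (x k)))"
    unfolding cos_coeff_def sin_coeff_def error_functional_def
    by (simp add: power2_eq_square algebra_simps)
  also have "(?c z)\<^sup>2 + (?s z)\<^sup>2 = ?c 0" by simp
  also have "?c z * (\<Sum>k=1..N. C k * ?c (x k)) + ?s z * (\<Sum>k=1..N. C k * ?s (x k))
      = (\<Sum>k=1..N. C k * ?c (z - x k))"
    unfolding d by (simp add: sum_distrib_left sum.distrib distrib_left mult_ac)
  also have "(\<Sum>k=1..N. C k * ?c (x k)) * (\<Sum>k=1..N. C k * ?c (x k))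
        + (\<Sum>k=1..N. C k * ?s (x k)) * (\<Sum>k=1..N. C k * ?s (x k))
      = (\<Sum>k=1..N. \<Sum>k'=1..N. C k * C k' * ?c (x k - x k'))"
    unfolding d by (simp add: sum_product sum.distrib distrib_left mult_ac)
  finally show ?thesis .
qed

end

theorem mainTheorem4:
  fixes m N :: nat and z :: real and x C :: "nat \<Rightarrow> real"
  assumes "m \<ge> 1" and "N \<ge> 1"
    and "z \<in> {0..1}"
    and "\<And>k. k \<in> {1..N} \<Longrightarrow> x k \<in> {0..1}"
    and "(\<Sum>k=1..N. C k) = 1"
  shows "error_functional N C x z \<in> periodic_L2_dual m \<and>
    complex_of_real ((periodic_L2_dual_norm m (error_functional N C x z))\<^sup>2) =
      (-1) ^ m * (bernoulli_even m 0
        - 2 * (\<Sum>k=1..N. of_real (C k) * bernoulli_even m (z - x k))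
        + (\<Sum>k=1..N. \<Sum>k'=1..N. of_real (C k) * of_real (C k') * bernoulli_even m (x k - x k')))"
proof -
  let ?t = "\<lambda>t n. 2 * cos (2 * pi * real (Suc n) * t) / (2 * pi * real (Suc n)) ^ (2 * m)"
  define b where "b t = (\<Sum>n. ?t t n)" for t
  have b: "?t t sums b t" for t
    unfolding b_def by (intro summable_sums summable_cos_bernoulli assms)
  have B: "bernoulli_even m t = (-1) ^ m * complex_of_real (b t)" for t
    unfolding b_def by (rule bernoulli_even_eq_suminf[OF assms(1)])
  \<comment> \<open>The bracket of the theorem, formed with the real series \<open>b\<close> without
    the sign; its n-th terms add up to \<open>mode_energy\<close> at \<open>Suc n\<close>.\<close>
  define S where "S = b 0 - 2 * (\<Sum>k=1..N. C k * b (z - x k))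
    + (\<Sum>k=1..N. \<Sum>k'=1..N. C k * C k' * b (x k - x k'))"
  have "(\<lambda>n. ?t 0 n - 2 * (\<Sum>k=1..N. C k * ?t (z - x k) n)
    + (\<Sum>k=1..N. \<Sum>k'=1..N. C k * C k' * ?t (x k - x k') n)) sums S"
    unfolding S_def by (intro sums_add sums_diff sums_mult sums_sum b)
  moreover have "?t 0 n - 2 * (\<Sum>k=1..N. C k * ?t (z - x k) n)
    + (\<Sum>k=1..N. \<Sum>k'=1..N. C k * C k' * ?t (x k - x k') n) = mode_energy m N z x C (Suc n)" for n
    unfolding mode_energy_def coeff_square_sum
    by (simp add: sum_distrib_left sum_divide_distrib add_divide_distrib diff_divide_distrib
        distrib_left right_diff_distrib mult_ac del: of_nat_Suc)
  ultimately have S: "(\<lambda>n. mode_energy m N z x C (Suc n)) sums S" by simp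
  \<comment> \<open>One sign stands in the theorem, the other is contained in
    \<open>bernoulli_even\<close>.\<close>
  have sgn: "(-1) ^ m * ((-1) ^ m * a) = a" for a :: complex
    by (simp flip: mult.assoc power_add)
  have "complex_of_real S = (-1) ^ m * (bernoulli_even m 0
        - 2 * (\<Sum>k=1..N. of_real (C k) * bernoulli_even m (z - x k))
        + (\<Sum>k=1..N. \<Sum>k'=1..N. of_real (C k) * of_real (C k') * bernoulli_even m (x k - x k')))"
    unfolding S_def B
    by (simp add: sum_distrib_left distrib_left right_diff_distrib mult.left_commute[of "(-1) ^ m"] sgn)
  then show ?thesis
    using error_functional_in_dual[OF assms(5) S] dual_norm_error_functional[OF assms(5) S] by simp
qed

end
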